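(* Let $\boldsymbol m=(m_j)_{j\in[K]}$ be a given GFQ requirement ($m_j\ge 0$, $M:=\sum_{j\in[K]}m_j\le B$), put $\theta_0:=1$, $C_j:=B-\sum_{i=1}^{j-1}m_i$ and $D_j:=\sum_{i=1}^{j-1}m_i\theta_i$. (1) Let $\alpha_0^*:=1+\ln\theta_K-\sum_{j=1}^{K-1}\frac{m_j}{B}\ln\left(\frac{\theta_K}{\theta_j}\right)$. If $M\le \frac{B}{\alpha_0^*}$, then Algorithm Q-Threshold is $\alpha_0^*$-competitive when its threshold function is $$\phi(u)=\begin{cases}1 & u\in[0,\Gamma^0],\\ \exp\left(\frac{\alpha_0^*(u+M)-B-\sum_{i=1}^{j-1}m_i\ln\theta_i}{C_j}\right) & u\in[\Gamma^{j-1},\Gamma^j],\ j\in[K],\end{cases}$$ where $\Gamma^0=\frac{B}{\alpha_0^*}-M$ and $\Gamma^j=\frac{B}{\alpha_0^*}-M+\frac{C_j}{\alpha_0^*}\ln\theta_j+\frac{1}{\alpha_0^*}\sum_{i=1}^{j-1}m_i\ln\theta_i$ for $j\in[K]$. (2) For $j^*\in[K]$ (and $M<B$) define $$\alpha_{j^*}=\frac{D_{j^*}}{M}+\frac{C_{j^*}}{B-M}\,W\!\left(\frac{\theta_K(B-M)}{M}\exp\left(-\frac{X}{C_{j^*}}\right)\exp\left(-\frac{D_{j^*}(B-M)}{C_{j^*}M}\right)\right),\qquad X=\sum_{i=j^*}^{K-1}m_i\ln\left(\frac{\theta_K}{\theta_i}\right),$$ where $W$ is the Lambert $W$ function. If $M\in\left(\frac{\theta_{j^*-1}C_{j^*}+D_{j^*}}{\alpha_{j^*}},\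 \frac{\theta_{j^*}C_{j^*}+D_{j^*}}{\alpha_{j^*}}\right]$ for some $j^*\in[K]$, then Algorithm Q-Threshold is $\alpha_{j^*}$-competitive when its threshold function is $$\phi(u)=v^*\exp\left(\frac{\alpha_{j^*}u-\sum_{i=j^*}^{j-1}m_i\ln\left(\frac{\theta_i}{v^*}\right)}{C_j}\right),\qquad u\in[\Gamma^{j-1}_{j^*},\Gamma^{j}_{j^*}],\ j\in\{j^*,\dots,K\},$$ where $v^*=(\alpha_{j^*}M-D_{j^*})/C_{j^*}$, $\Gamma_{j^*}^{j^*-1}=0$, and $\Gamma^j_{j^*}=\frac{C_j}{\alpha_{j^*}}\ln\frac{\theta_j}{v^*}+\frac{1}{\alpha_{j^*}}\sum_{i=j^*}^{j-1}m_i\ln\frac{\theta_i}{v^*}$ for $j\in\{j^*,\dots,K\}$.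
   Context: Setting. Fix a resource budget $B>0$, a number of classes $K\ge1$ and numbers $1\le\theta_1\le\dots\le\theta_K$; $[K]=\{1,\dots,K\}$. An instance is a finite sequence $I=\{(v_t,j_t,r_t)\}_{t=1}^T$ of agents, where $j_t\in[K]$ is the class, $v_t\in[1,\theta_{j_t}]$ the valuation and $r_t\ge0$ the rate limit of agent $t$. An online algorithm knows $B,K,(\theta_j)$ (and $\boldsymbol m$), but not $T$; when agent $t$ arrives it irrevocably chooses $x_t\in[0,r_t]$ depending only on the first $t$ agents, and $\sum_t x_t\le B$ must hold. Its value is $\mathrm{ALG}(I)=\sum_t v_tx_t$. GFQ (group fairness by quantity). An allocation satisfies GFQ with requirement $\boldsymbol m$ if $\sum_{t:\,j_t=j}x_t\ge m_j$ for all $j\in[K]$. Only instances in which every class $j$ contains enough agents to meet this, i.e. $\sum_{t: j_t=j}r_t\ge m_j$ for all $j\in[K]$, are considered. The offline optimum is $$\mathrm{OPT}(I)=\max\Big\{\sum_t v_tx_t:\ x_t\in[0,r_t],\ \sum_t x_t\le B,\ \sum_{t:j_t=j}x_t\ge m_j\ \forall j\in[K]\Big\}.$$ An online algorithm is $\alpha$-competitive if $\mathrm{OPT}(I)\le\alpha\,\mathrm{ALG}(I)$ for all such instances $I$. Algorithm Q-Threshold with nondecreasing threshold function $\phi:[0,B-M]\to[1,\theta_K]$. Initialize $u_0=0$ and $u^j_0=0$ for all $j$. When agent $t$ arrives: set $y_t=\min\{r_t,m_{j_t}-u^{j_t}_{t-1}\}$ if $u^{j_t}_{t-1}<m_{j_t}$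 and $y_t=0$ otherwise; set $u^{j_t}_t=u^{j_t}_{t-1}+y_t$ (other $u^j$ unchanged). If $v_t\ge\phi(u_{t-1})$, let $z_t$ be the largest maximizer of $a\,v_t-\int_{u_{t-1}}^{u_{t-1}+a}\phi(\eta)\,d\eta$ over $a\in[0,r_t-y_t]$ with $u_{t-1}+a\le B-M$; otherwise $z_t=0$. Set $u_t=u_{t-1}+z_t$ and allocate $x_t=y_t+z_t$. *)

theory Defs
  imports "HOL-Analysis.Analysis"
begin

datatype agent = Agent (valuation: real) (cls: nat) (rate: real)

(* Only the values of m and theta at the classes 1..K matter, and that of theta at 0, which the
   theorem fixes to the boundary convention theta 0 = 1. *)

definition valid_instance :: "nat \<Rightarrow> (nat \<Rightarrow> real) \<Rightarrow> (nat \<Rightarrow> real) \<Rightarrow> agent list \<Rightarrow> bool" where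
  "valid_instance K \<theta> m I \<longleftrightarrow>
     (\<forall>a\<in>set I. cls a \<in> {1..K} \<and> valuation a \<in> {1..\<theta> (cls a)} \<and> 0 \<le> rate a) \<and>
     (\<forall>j\<in>{1..K}. m j \<le> (\<Sum>t | t < length I \<and> cls (I ! t) = j. rate (I ! t)))"

definition satisfies_GFQ :: "nat \<Rightarrow> (nat \<Rightarrow> real) \<Rightarrow> agent list \<Rightarrow> (nat \<Rightarrow> real) \<Rightarrow> bool" where
  "satisfies_GFQ K m I x \<longleftrightarrow>
     (\<forall>j\<in>{1..K}. m j \<le> (\<Sum>t | t < length I \<and> cls (I ! t) = j. x t))"

definition feasible :: "real \<Rightarrow> nat \<Rightarrow> (nat \<Rightarrow> real) \<Rightarrow> agent list \<Rightarrow> (nat \<Rightarrow> real) \<Rightarrow> bool" where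
  "feasible B K m I x \<longleftrightarrow>
     (\<forall>t<length I. x t \<in> {0..rate (I ! t)}) \<and>
     (\<Sum>t<length I. x t) \<le> B \<and>
     satisfies_GFQ K m I x"

definition welfare :: "agent list \<Rightarrow> (nat \<Rightarrow> real) \<Rightarrow> real" where
  "welfare I x = (\<Sum>t<length I. valuation (I ! t) * x t)"

(* For a valid instance with sum of the m j at most B the feasible region is nonempty and compact,
   so the supremum is a maximum. *)
definition OPT :: "real \<Rightarrow> nat \<Rightarrow> (nat \<Rightarrow> real) \<Rightarrow> agent list \<Rightarrow> real" where
  "OPT B K m I = Sup (welfare I ` {x. feasible B K m I x})"

(* An online algorithm maps the list of the agents seen so far (the current one being last) to the
   amount given to the current agent; B, K, theta and m may enter as parameters of the algorithm. *)
type_synonym online_alg = "agent list \<Rightarrow> real"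

definition alloc :: "online_alg \<Rightarrow> agent list \<Rightarrow> nat \<Rightarrow> real" where
  "alloc A I t = A (take (Suc t) I)"

(* Being competitive includes that the algorithm always produces a feasible allocation, with all
   quotas met. *)
definition competitive ::
  "real \<Rightarrow> nat \<Rightarrow> (nat \<Rightarrow> real) \<Rightarrow> (nat \<Rightarrow> real) \<Rightarrow> online_alg \<Rightarrow> real \<Rightarrow> bool" where
  "competitive B K \<theta> m A \<alpha> \<longleftrightarrow>
     (\<forall>I. valid_instance K \<theta> m I \<longrightarrow>
        feasible B K m I (alloc A I) \<and> OPT B K m I \<le> \<alpha> * welfare I (alloc A I))"

definition quota_sum :: "nat \<Rightarrow> (nat \<Rightarrow> real) \<Rightarrow> real" where
  "quota_sum K m = (\<Sum>j=1..K. m j)"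

(* A state (u, w) consists of the amount u allocated through the threshold rule and the amount w j
   of the reserved quota m j already used by class j. *)

type_synonym qt_state = "real \<times> (nat \<Rightarrow> real)"

definition qt_y :: "(nat \<Rightarrow> real) \<Rightarrow> qt_state \<Rightarrow> agent \<Rightarrow> real" where
  "qt_y m s a = (case s of (u, w) \<Rightarrow>
     if w (cls a) < m (cls a) then min (rate a) (m (cls a) - w (cls a)) else 0)"

definition qt_z ::
  "real \<Rightarrow> nat \<Rightarrow> (nat \<Rightarrow> real) \<Rightarrow> (real \<Rightarrow> real) \<Rightarrow> qt_state \<Rightarrow> agent \<Rightarrow> real" where
  "qt_z B K m \<phi> s a = (case s of (u, w) \<Rightarrow>
     if valuation a \<ge> \<phi> u
     then (GREATEST z. is_arg_max (\<lambda>b. b * valuation a - integral {u..u + b} \<phi>)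
             (\<lambda>b. 0 \<le> b \<and> b \<le> rate a - qt_y m s a \<and> u + b \<le> B - quota_sum K m) z)
     else 0)"

definition qt_step ::
  "real \<Rightarrow> nat \<Rightarrow> (nat \<Rightarrow> real) \<Rightarrow> (real \<Rightarrow> real) \<Rightarrow> qt_state \<Rightarrow> agent \<Rightarrow> qt_state" where
  "qt_step B K m \<phi> s a = (case s of (u, w) \<Rightarrow>
     (u + qt_z B K m \<phi> s a, w(cls a := w (cls a) + qt_y m s a)))"

definition q_threshold ::
  "real \<Rightarrow> nat \<Rightarrow> (nat \<Rightarrow> real) \<Rightarrow> (real \<Rightarrow> real) \<Rightarrow> online_alg" where
  "q_threshold B K m \<phi> as =
     (let s = foldl (qt_step B K m \<phi>) (0, \<lambda>_. 0) (butlast as)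
      in qt_y m s (last as) + qt_z B K m \<phi> s (last as))"

definition threshold_function ::
  "real \<Rightarrow> nat \<Rightarrow> (nat \<Rightarrow> real) \<Rightarrow> (nat \<Rightarrow> real) \<Rightarrow> (real \<Rightarrow> real) \<Rightarrow> bool" where
  "threshold_function B K \<theta> m \<phi> \<longleftrightarrow>
     mono_on {0..B - quota_sum K m} \<phi> \<and> \<phi> \<in> {0..B - quota_sum K m} \<rightarrow> {1..\<theta> K}"

definition resid_C :: "real \<Rightarrow> (nat \<Rightarrow> real) \<Rightarrow> nat \<Rightarrow> real" where
  "resid_C B m j = B - (\<Sum>i=1..<j. m i)"

definition quota_D :: "(nat \<Rightarrow> real) \<Rightarrow> (nat \<Rightarrow> real) \<Rightarrow> nat \<Rightarrow> real" where
  "quota_D \<theta> m j = (\<Sum>i=1..<j. m i * \<theta> i)"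

definition alpha0 :: "real \<Rightarrow> nat \<Rightarrow> (nat \<Rightarrow> real) \<Rightarrow> (nat \<Rightarrow> real) \<Rightarrow> real" where
  "alpha0 B K \<theta> m = 1 + ln (\<theta> K) - (\<Sum>j=1..<K. m j / B * ln (\<theta> K / \<theta> j))"

definition breakpoint0 :: "real \<Rightarrow> nat \<Rightarrow> (nat \<Rightarrow> real) \<Rightarrow> (nat \<Rightarrow> real) \<Rightarrow> nat \<Rightarrow> real" where
  "breakpoint0 B K \<theta> m j = (let \<alpha> = alpha0 B K \<theta> m in
     if j = 0 then B / \<alpha> - quota_sum K m
     else B / \<alpha> - quota_sum K m + resid_C B m j / \<alpha> * ln (\<theta> j) + 1 / \<alpha> * (\<Sum>i=1..<j. m i * ln (\<theta> i)))"

(* The pieces overlap in the breakpoints, where their formulas agree; only the values of phi on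
   [0, B - M] are used by the algorithm, and these are determined by the pieces. *)
definition is_threshold0 ::
  "real \<Rightarrow> nat \<Rightarrow> (nat \<Rightarrow> real) \<Rightarrow> (nat \<Rightarrow> real) \<Rightarrow> (real \<Rightarrow> real) \<Rightarrow> bool" where
  "is_threshold0 B K \<theta> m \<phi> \<longleftrightarrow>
     (\<forall>u\<in>{0..breakpoint0 B K \<theta> m 0}. \<phi> u = 1) \<and>
     (\<forall>j\<in>{1..K}. \<forall>u\<in>{breakpoint0 B K \<theta> m (j - 1)..breakpoint0 B K \<theta> m j}.
        \<phi> u = exp ((alpha0 B K \<theta> m * (u + quota_sum K m) - B - (\<Sum>i=1..<j. m i * ln (\<theta> i))) / resid_C B m j))"

(* Principal branch; meaningful for x >= - exp (-1), and only used for x >= 0. *)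
definition lambert_W :: "real \<Rightarrow> real" where
  "lambert_W x = (THE w. -1 \<le> w \<and> w * exp w = x)"

(* Quota sum 0 makes the divisions by M junk; then alpha is 0 as well and the interval for M in
   the theorem is {0<..0}, so that this case is excluded there. *)
definition alpha :: "real \<Rightarrow> nat \<Rightarrow> (nat \<Rightarrow> real) \<Rightarrow> (nat \<Rightarrow> real) \<Rightarrow> nat \<Rightarrow> real" where
  "alpha B K \<theta> m j =
     (let M = quota_sum K m; X = (\<Sum>i=j..<K. m i * ln (\<theta> K / \<theta> i)) in
      quota_D \<theta> m j / M + resid_C B m j / (B - M) *
        lambert_W (\<theta> K * (B - M) / M * exp (- (X / resid_C B m j)) *
                   exp (- (quota_D \<theta> m j * (B - M) / (resid_C B m j * M)))))"

definition vstar :: "real \<Rightarrow> nat \<Rightarrow> (nat \<Rightarrow> real) \<Rightarrow> (nat \<Rightarrow> real) \<Rightarrow> nat \<Rightarrow> real" where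
  "vstar B K \<theta> m js = (alpha B K \<theta> m js * quota_sum K m - quota_D \<theta> m js) / resid_C B m js"

definition breakpoint ::
  "real \<Rightarrow> nat \<Rightarrow> (nat \<Rightarrow> real) \<Rightarrow> (nat \<Rightarrow> real) \<Rightarrow> nat \<Rightarrow> nat \<Rightarrow> real" where
  "breakpoint B K \<theta> m js j = (let \<alpha> = alpha B K \<theta> m js; v = vstar B K \<theta> m js in
     if j < js then 0
     else resid_C B m j / \<alpha> * ln (\<theta> j / v) + 1 / \<alpha> * (\<Sum>i=js..<j. m i * ln (\<theta> i / v)))"

definition is_threshold ::
  "real \<Rightarrow> nat \<Rightarrow> (nat \<Rightarrow> real) \<Rightarrow> (nat \<Rightarrow> real) \<Rightarrow> nat \<Rightarrow> (real \<Rightarrow> real) \<Rightarrow> bool" where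
  "is_threshold B K \<theta> m js \<phi> \<longleftrightarrow> (let v = vstar B K \<theta> m js in
     \<forall>j\<in>{js..K}. \<forall>u\<in>{breakpoint B K \<theta> m js (j - 1)..breakpoint B K \<theta> m js j}.
       \<phi> u = v * exp ((alpha B K \<theta> m js * u - (\<Sum>i=js..<j. m i * ln (\<theta> i / v))) / resid_C B m j))"

end

theory Submission
  imports Defs
begin

text \<open>
  The competitive ratio comes from linear programming duality. Let \<open>u\<close> be the final amount
  allocated through the threshold rule, and take \<open>p = \<phi> u\<close> as the price of the resource. Every
  agent valued above \<open>p\<close> has received its full rate, so the excess of the valuations over \<open>p\<close>
  contributes at least as much to the algorithm as to the optimum. With valuations truncated at \<open>p\<close>,
  the optimum is at most \<open>p * B - (\<Sum>j. max 0 (p - \<theta> j) * m j)\<close>, and the algorithm's value is at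
  least the quota sum \<open>M\<close> plus the integral of \<open>\<phi>\<close> over \<open>[0, u]\<close>. Both thresholds solve the differential equation
  obtained by requiring the former bound to be \<open>\<alpha>\<close> times the latter, where \<open>\<alpha>\<close> is chosen so
  that \<open>\<phi> (B - M) = \<theta> K\<close>. On the flat part of the first threshold no agent is ever rationed, so there
  \<open>p = 0\<close> is used instead.
\<close>

section \<open>The maximizer chosen by the threshold rule\<close>

text \<open>The maximizers of a continuous objective on a compact interval form a nonempty compact
  set, so \<open>GREATEST\<close> denotes one of them. Comparing with amount \<open>0\<close> bounds
  the integral. The last clause is what being the largest maximizer buys: an agent stops short of
  its limit only if every price further right exceeds \<open>v\<close>.\<close>

lemma greatest_maximizer:
  fixes \<phi> :: "real \<Rightarrow> real" and b r u v :: real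
  assumes cont: "continuous_on {0..b} \<phi>" and mono: "mono_on {0..b} \<phi>"
    and u: "u \<in> {0..b}" and r: "0 \<le> r"
  defines "z \<equiv> GREATEST z. is_arg_max (\<lambda>a. a * v - integral {u..u + a} \<phi>)
                             (\<lambda>a. 0 \<le> a \<and> a \<le> r \<and> u + a \<le> b) z"
  shows "0 \<le> z \<and> z \<le> r \<and> u + z \<le> b \<and> integral {u..u + z} \<phi> \<le> z * v \<and>
         (\<forall>\<eta>. z < r \<and> u + z < \<eta> \<and> \<eta> \<le> b \<longrightarrow> v < \<phi> \<eta>)"
proof -
  define f where "f = (\<lambda>a. a * v - integral {u..u + a} \<phi>)"
  define P where "P = (\<lambda>a. 0 \<le> a \<and> a \<le> r \<and> u + a \<le> b)"
  define S where "S = {0..min r (b - u)}"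
  have P_iff: "P a \<longleftrightarrow> a \<in> S" for a
    by (auto simp: P_def S_def)
  have int: "\<phi> integrable_on {c..d}" if "0 \<le> c" "d \<le> b" for c d
    using that cont by (intro integrable_continuous_interval continuous_on_subset[OF cont]) auto
  have contf: "continuous_on S f"
  proof -
    have "continuous_on {u..b} (\<lambda>x. integral {u..x} \<phi>)"
      using u by (intro indefinite_integral_continuous_1 int) auto
    then have "continuous_on S (\<lambda>a. integral {u..u + a} \<phi>)"
      by (rule continuous_on_compose2) (auto simp: S_def intro!: continuous_intros)
    then show ?thesis
      unfolding f_def by (intro continuous_intros)
  qed
  have S0: "0 \<in> S"
    using u r by (auto simp: S_def)
  have "compact S"
    by (simp add: S_def)
  then obtain a0 where a0: "a0 \<in> S" "\<And>a. a \<in> S \<Longrightarrow> f a \<le> f a0"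
    using continuous_attains_sup[OF _ _ contf] S0 by blast
  define A where "A = {a \<in> S. f a = f a0}"
  have "compact A"
    unfolding A_def
    by (rule closedin_compact[OF \<open>compact S\<close> continuous_closedin_preimage_constant[OF contf]])
  then obtain z0 where z0: "z0 \<in> A" "\<And>a. a \<in> A \<Longrightarrow> a \<le> z0"
    using compact_attains_sup[of A] a0(1) by (auto simp: A_def)
  have argmax: "is_arg_max f P a \<longleftrightarrow> a \<in> A" for a
    unfolding is_arg_max_def P_iff A_def using a0 by (auto simp: not_less intro: antisym)
  have "z = z0"
    unfolding z_def f_def[symmetric] P_def[symmetric] argmax
    using z0 by (intro Greatest_equality)
  then have zA: "z \<in> A" and zS: "z \<in> S"
    using z0 by (auto simp: A_def)
  have "f 0 \<le> f z"
    using zA a0(2)[OF S0] by (auto simp: A_def)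
  then have 1: "integral {u..u + z} \<phi> \<le> z * v"
    by (simp add: f_def)
  have 2: "v < \<phi> \<eta>" if "z < r" "u + z < \<eta>" "\<eta> \<le> b" for \<eta>
  proof (rule ccontr)
    assume "\<not> v < \<phi> \<eta>"
    \<comment> \<open>Up to \<open>u + a\<close> the price is at most \<open>\<phi> \<eta>\<close>,
      hence at most \<open>v\<close>, so enlarging \<open>z\<close> to \<open>a\<close> loses
      nothing and \<open>a\<close> would be a larger maximizer.\<close>
    define a where "a = min r (\<eta> - u)"
    have a: "z < a" "a \<in> S" "u + a \<le> \<eta>"
      using that zS by (auto simp: a_def S_def)
    have z: "0 \<le> z"
      using zS by (simp add: S_def)
    have split: "integral {u..u + z} \<phi> + integral {u + z..u + a} \<phi> = integral {u..u + a} \<phi>"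
      using a z u that by (intro Henstock_Kurzweil_Integration.integral_combine int) auto
    have "integral {u + z..u + a} \<phi> \<le> integral {u + z..u + a} (\<lambda>_. v)"
    proof (rule integral_le)
      show "\<phi> integrable_on {u + z..u + a}"
        using a z u that by (intro int) auto
      fix x assume "x \<in> {u + z..u + a}"
      then have "\<phi> x \<le> \<phi> \<eta>"
        using a z u that by (intro mono_onD[OF mono]) auto
      then show "\<phi> x \<le> v"
        using \<open>\<not> v < \<phi> \<eta>\<close> by simp
    qed auto
    also have "\<dots> = (a - z) * v"
      using a by simp
    finally have "f z \<le> f a"
      using split by (simp add: f_def algebra_simps)
    then have "a \<in> A"
      using zA a a0(2)[of a] by (auto simp: A_def)
    then show False
      using z0 a \<open>z = z0\<close> by fastforce
  qed
  show ?thesis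
    using zS 1 2 by (auto simp: S_def)
qed

subsection \<open>Competitiveness from dual prices\<close>

locale quota_classes =
  fixes B :: real and K :: nat and \<theta> m :: "nat \<Rightarrow> real"
  assumes B: "0 < B" and K: "1 \<le> K" and \<theta>_0: "\<theta> 0 = 1"
    and \<theta>_Suc: "\<And>j. j \<in> {1..K} \<Longrightarrow> \<theta> (j - 1) \<le> \<theta> j"
    and m_nonneg: "\<And>j. j \<in> {1..K} \<Longrightarrow> 0 \<le> m j" and quota_le: "quota_sum K m \<le> B"
begin

abbreviation "M \<equiv> quota_sum K m"

lemma \<theta>_mono: "i \<le> j \<Longrightarrow> j \<le> K \<Longrightarrow> \<theta> i \<le> \<theta> j"
proof (induction j rule: dec_induct)
  case (step n)
  then show ?case using \<theta>_Suc[of "Suc n"] by simp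
qed simp

lemma \<theta>_ge_1: "j \<le> K \<Longrightarrow> 1 \<le> \<theta> j"
  using \<theta>_mono[of 0 j] \<theta>_0 by simp

end

text \<open>Objective of the linear programming dual at resource price \<open>p\<close>, without the rate limit terms;
  the dual price of the quota of class \<open>j\<close> is the excess of \<open>p\<close> over \<open>\<theta> j\<close>.\<close>

definition dual_value :: "real \<Rightarrow> nat \<Rightarrow> (nat \<Rightarrow> real) \<Rightarrow> (nat \<Rightarrow> real) \<Rightarrow> real \<Rightarrow> real" where
  "dual_value B K \<theta> m p = p * B - (\<Sum>j\<in>{1..K}. max 0 (p - \<theta> j) * m j)"

section \<open>Runs of the algorithm\<close>

locale quota_problem = quota_classes +
  fixes \<phi> :: "real \<Rightarrow> real"
  assumes thr: "threshold_function B K \<theta> m \<phi>"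
    and cont: "continuous_on {0..B - quota_sum K m} \<phi>"
begin

abbreviation "b \<equiv> B - M"

text \<open>Agents are counted from 0: \<open>state I t\<close> is the state that agent
  \<open>I ! t\<close> meets.\<close>

definition state :: "agent list \<Rightarrow> nat \<Rightarrow> qt_state" where
  "state I t = foldl (qt_step B K m \<phi>) (0, \<lambda>_. 0) (take t I)"

definition u :: "agent list \<Rightarrow> nat \<Rightarrow> real" where "u I t = fst (state I t)"
definition w :: "agent list \<Rightarrow> nat \<Rightarrow> nat \<Rightarrow> real" where "w I t = snd (state I t)"
definition y :: "agent list \<Rightarrow> nat \<Rightarrow> real" where "y I t = qt_y m (state I t) (I ! t)"
definition z :: "agent list \<Rightarrow> nat \<Rightarrow> real" where "z I t = qt_z B K m \<phi> (state I t) (I ! t)"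
abbreviation "x \<equiv> alloc (q_threshold B K m \<phi>)"

lemma x_eq: "t < length I \<Longrightarrow> x I t = y I t + z I t"
  by (simp add: alloc_def q_threshold_def y_def z_def state_def butlast_take Let_def
      take_Suc_conv_app_nth)

lemma state_Suc:
  "t < length I \<Longrightarrow> state I (Suc t) = qt_step B K m \<phi> (state I t) (I ! t)"
  by (simp add: state_def take_Suc_conv_app_nth)

lemma u_Suc: "t < length I \<Longrightarrow> u I (Suc t) = u I t + z I t"
  by (simp add: u_def z_def state_Suc qt_step_def split: prod.split)

lemma w_Suc:
  "t < length I \<Longrightarrow> w I (Suc t) = (w I t)(cls (I ! t) := w I t (cls (I ! t)) + y I t)"
  by (simp add: w_def y_def state_Suc qt_step_def split: prod.split)

lemma u_0: "u I 0 = 0" and w_0: "w I 0 j = 0"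
  by (simp_all add: u_def w_def state_def)

lemma y_eq:
  "y I t = (if w I t (cls (I ! t)) < m (cls (I ! t))
            then min (rate (I ! t)) (m (cls (I ! t)) - w I t (cls (I ! t))) else 0)"
  by (simp add: y_def qt_y_def w_def split: prod.split)

lemma phi_mono: "0 \<le> c \<Longrightarrow> c \<le> d \<Longrightarrow> d \<le> b \<Longrightarrow> \<phi> c \<le> \<phi> d"
  using thr by (auto simp: threshold_function_def intro: mono_onD)

lemma phi_range: "0 \<le> c \<Longrightarrow> c \<le> b \<Longrightarrow> 1 \<le> \<phi> c \<and> \<phi> c \<le> \<theta> K"
  using thr by (auto simp: threshold_function_def)

lemma phi_integrable: "0 \<le> c \<Longrightarrow> d \<le> b \<Longrightarrow> \<phi> integrable_on {c..d}"
  using cont by (intro integrable_continuous_interval continuous_on_subset[OF cont]) auto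

context
  fixes I :: "agent list"
  assumes valid: "valid_instance K \<theta> m I"
begin

lemma agent:
  assumes "t < length I"
  shows "cls (I ! t) \<in> {1..K}" "1 \<le> valuation (I ! t)" "valuation (I ! t) \<le> \<theta> (cls (I ! t))"
    "0 \<le> rate (I ! t)"
  using valid assms by (auto simp: valid_instance_def)

lemma y_bounds: "t < length I \<Longrightarrow> 0 \<le> y I t \<and> y I t \<le> rate (I ! t)"
  using agent[of t] by (auto simp: y_eq)

text \<open>The bounds on \<open>u I t\<close> are hypotheses because they are themselves obtained
  from this lemma by induction; \<open>z_props\<close> discharges them.\<close>

lemma z_bounds:
  assumes t: "t < length I" and ut: "0 \<le> u I t" "u I t \<le> b"
  shows "0 \<le> z I t \<and> z I t \<le> rate (I ! t) - y I t \<and> u I (Suc t) \<le> b \<and>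
    integral {u I t..u I (Suc t)} \<phi> \<le> z I t * valuation (I ! t) \<and>
    (\<forall>\<eta>. z I t < rate (I ! t) - y I t \<and> u I (Suc t) < \<eta> \<and> \<eta> \<le> b \<longrightarrow> valuation (I ! t) < \<phi> \<eta>)"
proof (cases "\<phi> (u I t) \<le> valuation (I ! t)")
  case True
  then have "z I t = (GREATEST z. is_arg_max (\<lambda>a. a * valuation (I ! t) - integral {u I t..u I t + a} \<phi>)
                             (\<lambda>a. 0 \<le> a \<and> a \<le> rate (I ! t) - y I t \<and> u I t + a \<le> b) z)"
    by (auto simp: z_def qt_z_def u_def y_def split_beta)
  moreover have "mono_on {0..b} \<phi>"
    using thr by (simp add: threshold_function_def)
  ultimately show ?thesis
    using greatest_maximizer[OF cont, of "u I t" "rate (I ! t) - y I t" "valuation (I ! t)"]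
      ut y_bounds[OF t] u_Suc[OF t] by auto
next
  case False
  then have "z I t = 0"
    by (simp add: z_def qt_z_def u_def split_beta)
  \<comment> \<open>A rejected agent is priced out at the current amount already, hence at every
    larger one.\<close>
  moreover have "valuation (I ! t) < \<phi> \<eta>" if "u I t < \<eta>" "\<eta> \<le> b" for \<eta>
    using False phi_mono[of "u I t" \<eta>] that ut by simp
  ultimately show ?thesis
    using ut y_bounds[OF t] u_Suc[OF t] by auto
qed

lemma u_bounds: "t \<le> length I \<Longrightarrow> 0 \<le> u I t \<and> u I t \<le> b"
proof (induction t)
  case 0
  then show ?case using quota_le by (simp add: u_0)
next
  case (Suc t)
  then show ?case using z_bounds[of t] u_Suc[of t] by auto
qed

lemma z_props:
  assumes "t < length I"
  shows "0 \<le> z I t" "z I t \<le> rate (I ! t) - y I t" "u I t \<le> u I (Suc t)" "u I (Suc t) \<le> b"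
    "integral {u I t..u I (Suc t)} \<phi> \<le> z I t * valuation (I ! t)"
    "z I t < rate (I ! t) - y I t \<Longrightarrow> u I (Suc t) < \<eta> \<Longrightarrow> \<eta> \<le> b \<Longrightarrow> valuation (I ! t) < \<phi> \<eta>"
  using z_bounds[of t] u_bounds[of t] u_Suc[of t] assms by auto

lemma u_mono: "s \<le> t \<Longrightarrow> t \<le> length I \<Longrightarrow> u I s \<le> u I t"
proof (induction t rule: dec_induct)
  case (step t)
  then show ?case using z_props(3)[of t] by simp
qed simp

lemma z_sum: "t \<le> length I \<Longrightarrow> (\<Sum>i<t. z I i) = u I t"
  by (induction t) (auto simp: u_0 u_Suc)

lemma sum_class_Suc:
  "(\<Sum>i | i < Suc t \<and> cls (I ! i) = j. f i) =
   (\<Sum>i | i < t \<and> cls (I ! i) = j. f i) + (if cls (I ! t) = j then f t else (0 :: real))"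
proof -
  have "{i. i < Suc t \<and> cls (I ! i) = j} =
      (if cls (I ! t) = j then insert t else id) {i. i < t \<and> cls (I ! i) = j}"
    by (auto simp: less_Suc_eq)
  then show ?thesis by auto
qed

text \<open>Reservations are filled greedily, so the used quota is the total rate seen, capped at
  \<open>m j\<close>. For a valid instance the cap is reached, which makes every quota met exactly
  by the \<open>y\<close> part.\<close>

lemma w_eq:
  assumes "t \<le> length I" "j \<in> {1..K}"
  shows "w I t j = min (m j) (\<Sum>i | i < t \<and> cls (I ! i) = j. rate (I ! i)) \<and>
         w I t j = (\<Sum>i | i < t \<and> cls (I ! i) = j. y I i)"
  using assms
proof (induction t)
  case 0
  then show ?case using m_nonneg[of j] by (simp add: w_0)
next
  case (Suc t)
  then show ?case
    using agent(4)[of t] by (auto simp: w_Suc sum_class_Suc y_eq)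
qed

lemma y_class:
  "j \<in> {1..K} \<Longrightarrow> (\<Sum>i | i < length I \<and> cls (I ! i) = j. y I i) = m j"
  using w_eq[of "length I" j] valid by (auto simp: valid_instance_def)

lemma sum_by_class:
  "(\<Sum>t<length I. f t) = (\<Sum>j\<in>{1..K}. \<Sum>t | t < length I \<and> cls (I ! t) = j. (f t :: real))"
proof -
  have "(\<lambda>t. cls (I ! t)) ` {..<length I} \<subseteq> {1..K}"
    using agent(1) by auto
  from sum.group[OF _ _ this, of f] show ?thesis
    by simp
qed

lemma y_sum: "(\<Sum>t<length I. y I t) = quota_sum K m"
  using y_class by (simp add: sum_by_class quota_sum_def)

lemma feasible_x: "feasible B K m I (x I)"
proof -
  have "(\<Sum>t<length I. x I t) = quota_sum K m + u I (length I)"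
    by (simp add: x_eq sum.distrib y_sum z_sum)
  moreover have "m j \<le> (\<Sum>t | t < length I \<and> cls (I ! t) = j. x I t)" if "j \<in> {1..K}" for j
    unfolding y_class[OF that, symmetric] using z_props(1) by (intro sum_mono) (auto simp: x_eq)
  ultimately show ?thesis
    using u_bounds[of "length I"] y_bounds z_props(1,2)
    by (force simp: feasible_def satisfies_GFQ_def x_eq)
qed

text \<open>Each increment of the integral has two upper bounds: \<open>z I t\<close> times the
  valuation, by the choice of the maximizer, and \<open>z I t\<close> times \<open>p\<close>, since
  \<open>\<phi>\<close> has not passed \<open>p\<close> yet.\<close>

lemma integral_le_z:
  assumes "t \<le> length I" "\<phi> (u I t) \<le> p"
  shows "integral {0..u I t} \<phi> \<le> (\<Sum>i<t. min (valuation (I ! i)) p * z I i)"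
  using assms
proof (induction t)
  case 0
  then show ?case by (simp add: u_0)
next
  case (Suc t)
  have ut: "0 \<le> u I t" "u I t \<le> u I (Suc t)" "u I (Suc t) \<le> b"
    using u_bounds[of t] z_props[of t] Suc by auto
  have le: "\<phi> \<eta> \<le> p" if "0 \<le> \<eta>" "\<eta> \<le> u I (Suc t)" for \<eta>
    using phi_mono[of \<eta> "u I (Suc t)"] that ut Suc by simp
  have "integral {u I t..u I (Suc t)} \<phi> \<le> integral {u I t..u I (Suc t)} (\<lambda>_. p)"
    using ut le by (intro integral_le phi_integrable) auto
  also have "\<dots> = p * z I t"
    using ut Suc by (simp add: u_Suc)
  finally have "integral {u I t..u I (Suc t)} \<phi> \<le> min (valuation (I ! t)) p * z I t"
    using z_props(5)[of t] Suc by (auto simp: min_def mult.commute)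
  moreover have "integral {0..u I t} \<phi> + integral {u I t..u I (Suc t)} \<phi> = integral {0..u I (Suc t)} \<phi>"
    using ut by (intro Henstock_Kurzweil_Integration.integral_combine phi_integrable) auto
  ultimately show ?case
    using Suc le[of "u I t"] ut by simp
qed

end

section \<open>Weak duality\<close>

text \<open>Here \<open>c\<close> ranges over the possible final amounts of the threshold rule. The
  first condition on \<open>p\<close> ensures that agents valued above \<open>p\<close> are never
  rationed; the second compares the dual objective with the guaranteed value. The comparison is
  waived for \<open>p = 0\<close>, where all agents are served in full.\<close>

lemma competitiveI:
  assumes \<alpha>: "1 \<le> \<alpha>"
    and price: "\<And>c. 0 \<le> c \<Longrightarrow> c \<le> b \<Longrightarrow> \<exists>p.
        (\<forall>v. 1 \<le> v \<and> v \<le> \<theta> K \<and> p < v \<longrightarrow> (\<exists>\<eta>. c < \<eta> \<and> \<eta> \<le> b \<and> \<phi> \<eta> \<le> v)) \<and>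
        (p = 0 \<or> \<phi> c \<le> p \<and> dual_value B K \<theta> m p \<le> \<alpha> * (quota_sum K m + integral {0..c} \<phi>))"
  shows "competitive B K \<theta> m (q_threshold B K m \<phi>) \<alpha>"
  unfolding competitive_def
proof (intro allI impI conjI)
  have \<theta>: "0 \<le> \<theta> j \<and> \<theta> j \<le> \<theta> K" if "j \<in> {1..K}" for j
    using that \<theta>_ge_1[of j] \<theta>_mono[of j K] by auto
  fix I assume valid: "valid_instance K \<theta> m I"
  note ag = agent[OF valid] and zp = z_props[OF valid] and yb = y_bounds[OF valid]
  show feas: "feasible B K m I (x I)"
    by (rule feasible_x[OF valid])
  let ?T = "length I"
  have uT: "0 \<le> u I ?T" "u I ?T \<le> b"
    using u_bounds[OF valid, of ?T] by auto
  from price[OF uT] obtain p where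
    full: "\<And>v. 1 \<le> v \<Longrightarrow> v \<le> \<theta> K \<Longrightarrow> p < v \<Longrightarrow> \<exists>\<eta>. u I ?T < \<eta> \<and> \<eta> \<le> b \<and> \<phi> \<eta> \<le> v" and
    bound: "p = 0 \<or> \<phi> (u I ?T) \<le> p \<and> dual_value B K \<theta> m p \<le> \<alpha> * (quota_sum K m + integral {0..u I ?T} \<phi>)"
    by auto
  have p0: "0 \<le> p" and p1: "p \<noteq> 0 \<Longrightarrow> 1 \<le> p"
    using bound phi_range[OF uT] by auto
  \<comment> \<open>A shortfall would make \<open>\<phi>\<close> exceed the valuation everywhere
    beyond the amount reached after \<open>t\<close>, contradicting the \<open>\<eta>\<close> beyond
    the final amount.\<close>
  have x_full: "x I t = rate (I ! t)" if t: "t < ?T" and "p < valuation (I ! t)" for t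
  proof (rule ccontr)
    assume "x I t \<noteq> rate (I ! t)"
    then have "z I t < rate (I ! t) - y I t"
      using zp(2)[OF t] t by (simp add: x_eq)
    moreover obtain \<eta> where "u I ?T < \<eta>" "\<eta> \<le> b" "\<phi> \<eta> \<le> valuation (I ! t)"
      using full[of "valuation (I ! t)"] ag[OF t] \<theta>[of "cls (I ! t)"] \<open>p < _\<close> by fastforce
    moreover have "u I (Suc t) \<le> u I ?T"
      using u_mono[OF valid, of "Suc t" ?T] t by simp
    ultimately show False
      using zp(6)[OF t, of \<eta>] by simp
  qed
  have x0: "0 \<le> x I t" if "t < ?T" for t
    using zp(1) yb that by (force simp: x_eq)
  \<comment> \<open>For \<open>p = 0\<close> both sides vanish. Otherwise \<open>p\<close> is at
    least 1, so each truncated valuation is at least 1 and the reserved part is worth at least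
    \<open>M\<close>.\<close>
  have alg: "dual_value B K \<theta> m p \<le> \<alpha> * (\<Sum>t<?T. min (valuation (I ! t)) p * x I t)"
  proof (cases "p = 0")
    case True
    have "min (valuation (I ! t)) 0 = 0" if "t < ?T" for t
      using ag(2)[OF that] by simp
    moreover have "(\<Sum>j = Suc 0..K. max 0 (- \<theta> j) * m j) = 0"
      using \<theta> by (intro sum.neutral) auto
    ultimately show ?thesis
      using True by (simp add: dual_value_def)
  next
    case False
    have "quota_sum K m = (\<Sum>t<?T. 1 * y I t)"
      using y_sum[OF valid] by simp
    also have "\<dots> \<le> (\<Sum>t<?T. min (valuation (I ! t)) p * y I t)"
      using ag(2) p1[OF False] yb by (intro sum_mono mult_right_mono) auto
    finally have "quota_sum K m + integral {0..u I ?T} \<phi> \<le>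
        (\<Sum>t<?T. min (valuation (I ! t)) p * y I t) + (\<Sum>t<?T. min (valuation (I ! t)) p * z I t)"
      using integral_le_z[OF valid, of ?T p] bound False by simp
    also have "\<dots> = (\<Sum>t<?T. min (valuation (I ! t)) p * x I t)"
      by (simp add: x_eq distrib_left sum.distrib)
    finally have "\<alpha> * (quota_sum K m + integral {0..u I ?T} \<phi>) \<le> \<alpha> * \<dots>"
      using \<alpha> by (intro mult_left_mono) auto
    then show ?thesis
      using bound False by simp
  qed
  have main: "welfare I x' \<le> \<alpha> * welfare I (x I)" if x': "feasible B K m I x'" for x'
  proof -
    have x'b: "0 \<le> x' t" "x' t \<le> rate (I ! t)" if "t < ?T" for t
      using x' that by (auto simp: feasible_def)
    let ?e = "\<lambda>t. max 0 (valuation (I ! t) - p)"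
    let ?q = "\<lambda>j. max 0 (p - \<theta> j)"
    \<comment> \<open>Split each valuation at \<open>p\<close>. The excess is either 0 or belongs to
      an agent served in full, so \<open>x'\<close> may be replaced by \<open>x\<close>; the
      truncated part is at most the minimum of \<open>p\<close> and the \<open>\<theta>\<close> of
      the class, which is \<open>p - ?q\<close>.\<close>
    have "welfare I x' \<le> (\<Sum>t<?T. ?e t * x I t + (p * x' t - ?q (cls (I ! t)) * x' t))"
      unfolding welfare_def
    proof (rule sum_mono)
      fix t assume "t \<in> {..<?T}"
      then have t: "t < ?T" by simp
      have "?e t * x' t \<le> ?e t * x I t"
        using x_full[OF t] x'b[OF t] by (cases "p < valuation (I ! t)") (auto intro: mult_left_mono)
      moreover have "(valuation (I ! t) - ?e t) * x' t \<le> (p - ?q (cls (I ! t))) * x' t"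
        using ag[OF t] x'b[OF t] by (intro mult_right_mono) auto
      ultimately show "valuation (I ! t) * x' t \<le> ?e t * x I t + (p * x' t - ?q (cls (I ! t)) * x' t)"
        by (simp add: algebra_simps)
    qed
    also have "\<dots> = (\<Sum>t<?T. ?e t * x I t) + (p * (\<Sum>t<?T. x' t) - (\<Sum>t<?T. ?q (cls (I ! t)) * x' t))"
      by (simp add: sum.distrib sum_subtractf sum_distrib_left)
    also have "\<dots> \<le> (\<Sum>t<?T. ?e t * x I t) + dual_value B K \<theta> m p"
    proof -
      \<comment> \<open>The quotas enter here: \<open>?q\<close> is nonnegative, so class totals of
        \<open>x'\<close> may be lowered to \<open>m j\<close>.\<close>
      have "(\<Sum>j\<in>{1..K}. ?q j * m j) \<le> (\<Sum>j\<in>{1..K}. ?q j * (\<Sum>t | t < ?T \<and> cls (I ! t) = j. x' t))"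
        using x' by (intro sum_mono mult_left_mono) (auto simp: feasible_def satisfies_GFQ_def)
      also have "\<dots> = (\<Sum>t<?T. ?q (cls (I ! t)) * x' t)"
        unfolding sum_by_class[OF valid] by (intro sum.cong refl) (simp add: sum_distrib_left)
      finally have "(\<Sum>j\<in>{1..K}. ?q j * m j) \<le> \<dots>" .
      moreover have "p * (\<Sum>t<?T. x' t) \<le> p * B"
        using x' p0 by (intro mult_left_mono) (auto simp: feasible_def)
      ultimately show ?thesis
        by (simp add: dual_value_def)
    qed
    also have "\<dots> \<le> \<alpha> * (\<Sum>t<?T. ?e t * x I t) + \<alpha> * (\<Sum>t<?T. min (valuation (I ! t)) p * x I t)"
    proof -
      have "0 \<le> (\<Sum>t<?T. ?e t * x I t)"
        using x0 by (intro sum_nonneg mult_nonneg_nonneg) auto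
      then have "1 * (\<Sum>t<?T. ?e t * x I t) \<le> \<alpha> * (\<Sum>t<?T. ?e t * x I t)"
        using \<alpha> by (intro mult_right_mono)
      then show ?thesis
        using alg by simp
    qed
    \<comment> \<open>Excess and truncated valuation add up to the valuation.\<close>
    also have "\<dots> = \<alpha> * welfare I (x I)"
      unfolding welfare_def distrib_left[symmetric] sum.distrib[symmetric] distrib_right[symmetric]
      by (intro arg_cong2[where f = "(*)"] sum.cong refl) auto
    finally show ?thesis .
  qed
  show "OPT B K m I \<le> \<alpha> * welfare I (x I)"
    \<comment> \<open>The set under \<open>Sup\<close> is nonempty because the algorithm's own
      allocation is feasible.\<close>
    unfolding OPT_def using feas main by (intro cSup_least) auto
qed

end

subsection \<open>Piecewise exponential thresholds\<close>

text \<open>The pieces fit together because the gap from \<open>g k\<close> to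
  \<open>g (Suc k)\<close> is the length over which an exponential of rate
  \<open>\<alpha> / C k\<close> climbs from \<open>\<tau> k\<close> to
  \<open>\<tau> (Suc k)\<close>.\<close>

lemma exp_pieces_exist:
  fixes g \<tau> C :: "nat \<Rightarrow> real" and \<alpha> :: real
  assumes "\<alpha> > 0" and "s \<le> n"
    and pos: "\<And>k. k \<in> {s..<n} \<Longrightarrow> 0 < C k \<and> 0 < \<tau> k \<and> \<tau> k \<le> \<tau> (Suc k)"
    and g: "\<And>k. k \<in> {s..<n} \<Longrightarrow> g (Suc k) = g k + C k * ln (\<tau> (Suc k) / \<tau> k) / \<alpha>"
  shows "\<exists>\<phi>. (\<forall>u \<le> g s. \<phi> u = \<tau> s) \<and> g s \<le> g n \<and> \<phi> (g n) = \<tau> n \<and>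
    (\<forall>k\<in>{s..<n}. g k \<le> g n \<and> g (Suc k) \<le> g n \<and>
       (\<forall>u\<in>{g k..g (Suc k)}. \<phi> u = \<tau> k * exp (\<alpha> * (u - g k) / C k)))"
  using \<open>s \<le> n\<close> pos g
proof (induction n rule: dec_induct)
  case base
  then show ?case by auto
next
  case (step n)
  have sub: "k \<in> {s..<n} \<Longrightarrow> k \<in> {s..<Suc n}" for k
    by simp
  from step.IH[OF step.prems(1)[OF sub] step.prems(2)[OF sub]]
  obtain \<phi> where \<phi>: "\<forall>u \<le> g s. \<phi> u = \<tau> s" "g s \<le> g n" "\<phi> (g n) = \<tau> n"
    "\<And>k. k \<in> {s..<n} \<Longrightarrow> g k \<le> g n \<and> g (Suc k) \<le> g n"
    "\<And>k u. k \<in> {s..<n} \<Longrightarrow> u \<in> {g k..g (Suc k)} \<Longrightarrow> \<phi> u = \<tau> k * exp (\<alpha> * (u - g k) / C k)"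
    by blast
  have n: "0 < C n" "0 < \<tau> n" "\<tau> n \<le> \<tau> (Suc n)" "g (Suc n) = g n + C n * ln (\<tau> (Suc n) / \<tau> n) / \<alpha>"
    using step by auto
  have le: "g n \<le> g (Suc n)"
    using n \<open>\<alpha> > 0\<close> by simp
  have end_val: "\<tau> n * exp (\<alpha> * (g (Suc n) - g n) / C n) = \<tau> (Suc n)"
    using n \<open>\<alpha> > 0\<close> by simp
  \<comment> \<open>Only values beyond \<open>g n\<close> change; the bounds by \<open>g n\<close>
    carried through the induction keep the earlier pieces intact.\<close>
  define \<psi> where "\<psi> = (\<lambda>u. if u \<le> g n then \<phi> u else \<tau> n * exp (\<alpha> * (u - g n) / C n))"
  have last: "\<psi> u = \<tau> n * exp (\<alpha> * (u - g n) / C n)" if "g n \<le> u" for u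
    using that \<phi>(3) by (cases "u = g n") (auto simp: \<psi>_def)
  have "g k \<le> g (Suc n) \<and> g (Suc k) \<le> g (Suc n) \<and>
       (\<forall>u\<in>{g k..g (Suc k)}. \<psi> u = \<tau> k * exp (\<alpha> * (u - g k) / C k))" if "k \<in> {s..<Suc n}" for k
  proof (cases "k = n")
    case True
    then show ?thesis using last le by auto
  next
    case False
    then have k: "k \<in> {s..<n}" using that by auto
    then show ?thesis using \<phi>(4)[OF k] \<phi>(5)[OF k] le by (auto simp: \<psi>_def)
  qed
  moreover have "\<forall>u \<le> g s. \<psi> u = \<tau> s"
    using \<phi>(1,2) by (auto simp: \<psi>_def)
  moreover have "\<psi> (g (Suc n)) = \<tau> (Suc n)"
    using last[OF le] end_val by simp
  ultimately show ?case
    using \<phi>(2) le by (intro exI[of _ \<psi>]) auto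
qed

text \<open>On piece \<open>k\<close> the derivative of \<open>\<phi>\<close> is
  \<open>\<alpha> / C k\<close> times \<open>\<phi>\<close>, so the integral of
  \<open>\<phi>\<close> is the increment of \<open>\<phi>\<close> times
  \<open>C k / \<alpha>\<close>. As \<open>H\<close> has slope \<open>C k\<close> on the matching
  range of prices, this telescopes over the pieces. \<open>H\<close> will be the dual
  objective.\<close>

lemma exp_pieces:
  fixes g \<tau> C :: "nat \<Rightarrow> real" and \<alpha> :: real and \<phi> H :: "real \<Rightarrow> real"
  assumes \<alpha>: "\<alpha> > 0" and "s \<le> n"
    and pos: "\<And>k. k \<in> {s..<n} \<Longrightarrow> 0 < C k \<and> 0 < \<tau> k \<and> \<tau> k \<le> \<tau> (Suc k)"
    and g: "\<And>k. k \<in> {s..<n} \<Longrightarrow> g (Suc k) = g k + C k * ln (\<tau> (Suc k) / \<tau> k) / \<alpha>"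
    and start: "\<phi> (g s) = \<tau> s"
    and piece: "\<And>k u. k \<in> {s..<n} \<Longrightarrow> u \<in> {g k..g (Suc k)} \<Longrightarrow> \<phi> u = \<tau> k * exp (\<alpha> * (u - g k) / C k)"
    and H: "\<And>k p. k \<in> {s..<n} \<Longrightarrow> \<tau> k \<le> p \<Longrightarrow> p \<le> \<tau> (Suc k) \<Longrightarrow> H p - H (\<tau> k) = C k * (p - \<tau> k)"
  shows "g s \<le> g n \<and> \<phi> (g n) = \<tau> n \<and> continuous_on {g s..g n} \<phi> \<and> mono_on {g s..g n} \<phi> \<and>
    (\<forall>u\<in>{g s..g n}. (\<phi> has_integral (H (\<phi> u) - H (\<tau> s)) / \<alpha>) {g s..u})"
  using \<open>s \<le> n\<close> pos g piece H
proof (induction n rule: dec_induct)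
  case base
  then show ?case using start by (auto simp: mono_on_def has_integral_refl)
next
  case (step n)
  have IH: "g s \<le> g n" "\<phi> (g n) = \<tau> n" "continuous_on {g s..g n} \<phi>" "mono_on {g s..g n} \<phi>"
    "\<And>u. u \<in> {g s..g n} \<Longrightarrow> (\<phi> has_integral (H (\<phi> u) - H (\<tau> s)) / \<alpha>) {g s..u}"
    using step.IH step.prems by (simp_all add: less_SucI)
  have n: "0 < C n" "0 < \<tau> n" "\<tau> n \<le> \<tau> (Suc n)" "g (Suc n) = g n + C n * ln (\<tau> (Suc n) / \<tau> n) / \<alpha>"
    and last: "\<And>u. u \<in> {g n..g (Suc n)} \<Longrightarrow> \<phi> u = \<tau> n * exp (\<alpha> * (u - g n) / C n)"
    and Hn: "\<And>p. \<tau> n \<le> p \<Longrightarrow> p \<le> \<tau> (Suc n) \<Longrightarrow> H p - H (\<tau> n) = C n * (p - \<tau> n)"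
    using step by auto
  have le: "g n \<le> g (Suc n)"
    using n \<alpha> by simp
  have end_val: "\<phi> (g (Suc n)) = \<tau> (Suc n)"
    using n \<alpha> last[of "g (Suc n)"] le by simp
  have un: "{g s..g (Suc n)} = {g s..g n} \<union> {g n..g (Suc n)}"
    using IH(1) le by auto
  have mono_last: "\<phi> c \<le> \<phi> d" if "g n \<le> c" "c \<le> d" "d \<le> g (Suc n)" for c d
    using that n \<alpha> by (auto simp: last intro!: divide_right_mono)
  have cont_last: "continuous_on {g n..g (Suc n)} \<phi>"
    by (rule continuous_on_eq[where f = "\<lambda>u. \<tau> n * exp (\<alpha> * (u - g n) / C n)"])
      (use n in \<open>auto simp: last intro!: continuous_intros\<close>)
  have "continuous_on {g s..g (Suc n)} \<phi>"
    unfolding un using IH(3) cont_last by (intro continuous_on_closed_Un) auto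
  moreover have "mono_on {g s..g (Suc n)} \<phi>"
  proof (rule mono_onI)
    fix c d assume cd: "c \<in> {g s..g (Suc n)}" "d \<in> {g s..g (Suc n)}" "c \<le> d"
    consider "d \<le> g n" | "c \<le> g n" "g n \<le> d" | "g n \<le> c" by linarith
    then show "\<phi> c \<le> \<phi> d"
    proof cases
      case 1
      then show ?thesis using cd by (intro mono_onD[OF IH(4)]) auto
    next
      case 2
      then have "\<phi> c \<le> \<phi> (g n)" "\<phi> (g n) \<le> \<phi> d"
        using cd IH(1) mono_onD[OF IH(4), of c "g n"] mono_last[of "g n" d] by auto
      then show ?thesis by simp
    next
      case 3
      then show ?thesis using cd by (intro mono_last) auto
    qed
  qed
  moreover have "(\<phi> has_integral (H (\<phi> u) - H (\<tau> s)) / \<alpha>) {g s..u}"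
    if u: "u \<in> {g s..g (Suc n)}" for u
  proof (cases "u \<le> g n")
    case True
    then show ?thesis using u IH(5) by simp
  next
    case False
    \<comment> \<open>The antiderivative on this piece is \<open>\<phi>\<close> itself, scaled by
      \<open>C n / \<alpha>\<close>.\<close>
    have "(\<phi> has_integral C n / \<alpha> * \<phi> u - C n / \<alpha> * \<phi> (g n)) {g n..u}"
    proof (rule fundamental_theorem_of_calculus)
      fix t assume t: "t \<in> {g n..u}"
      have "((\<lambda>u. C n / \<alpha> * (\<tau> n * exp (\<alpha> * (u - g n) / C n))) has_vector_derivative \<phi> t) (at t within {g n..u})"
        using n \<alpha> t u last[of t] unfolding has_real_derivative_iff_has_vector_derivative[symmetric]
        by (auto intro!: derivative_eq_intros simp: field_simps)
      then show "((\<lambda>u. C n / \<alpha> * \<phi> u) has_vector_derivative \<phi> t) (at t within {g n..u})"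
        by (rule has_vector_derivative_transform[rotated 2]) (use t u last in auto)
    qed (use False in simp)
    moreover have "\<tau> n \<le> \<phi> u" "\<phi> u \<le> \<tau> (Suc n)"
      using False u mono_last[of "g n" u] mono_last[of u "g (Suc n)"] IH(2) end_val by auto
    then have "C n / \<alpha> * \<phi> u - C n / \<alpha> * \<phi> (g n) = (H (\<phi> u) - H (\<tau> n)) / \<alpha>"
      using Hn[of "\<phi> u"] IH(2) by (simp add: right_diff_distrib diff_divide_distrib)
    moreover have "(\<phi> has_integral (H (\<tau> n) - H (\<tau> s)) / \<alpha>) {g s..g n}"
      using IH(1,2) IH(5)[of "g n"] by simp
    ultimately have "(\<phi> has_integral (H (\<tau> n) - H (\<tau> s)) / \<alpha> + (H (\<phi> u) - H (\<tau> n)) / \<alpha>) {g s..u}"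
      using IH(1) False by (intro has_integral_combine[of "g s" "g n" u]) auto
    then show ?thesis
      by (simp add: diff_divide_distrib)
  qed
  ultimately show ?case
    using IH(1) le end_val by auto
qed

text \<open>Only the classes up to \<open>k\<close> have a nonzero positive part, and theirs is
  linear in \<open>p\<close>. Hence the slope in this price range is
  \<open>resid_C B m (Suc k)\<close>.\<close>

lemma dual_value_eq:
  assumes "k \<le> K" and "\<And>i. i \<in> {1..k} \<Longrightarrow> \<theta> i \<le> p" and "\<And>i. i \<in> {Suc k..K} \<Longrightarrow> p \<le> \<theta> i"
  shows "dual_value B K \<theta> m p = p * resid_C B m (Suc k) + quota_D \<theta> m (Suc k)"
proof -
  have "{1..K} = {1..k} \<union> {Suc k..K}"
    using assms(1) by auto
  then have "(\<Sum>j\<in>{1..K}. max 0 (p - \<theta> j) * m j)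
      = (\<Sum>j\<in>{1..k}. max 0 (p - \<theta> j) * m j) + (\<Sum>j\<in>{Suc k..K}. max 0 (p - \<theta> j) * m j)"
    by (simp only:) (rule sum.union_disjoint, auto)
  also have "(\<Sum>j\<in>{Suc k..K}. max 0 (p - \<theta> j) * m j) = 0"
    using assms(3) by (intro sum.neutral) auto
  also have "(\<Sum>j\<in>{1..k}. max 0 (p - \<theta> j) * m j) = (\<Sum>j\<in>{1..<Suc k}. p * m j - m j * \<theta> j)"
    using assms(2) by (intro sum.cong) (auto simp: algebra_simps max_def)
  also have "\<dots> = p * (\<Sum>j=1..<Suc k. m j) - (\<Sum>j=1..<Suc k. m j * \<theta> j)"
    by (simp only: sum_subtractf sum_distrib_left)
  finally show ?thesis
    by (simp add: dual_value_def resid_C_def quota_D_def algebra_simps)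
qed

text \<open>The common form of the two threshold functions: the value \<open>v\<close> up to \<open>c\<close>, followed by
  exponential pieces for the classes from \<open>s\<close> on.\<close>

locale threshold_pieces = quota_classes +
  fixes \<alpha> v c :: real and s :: nat
  assumes quota_less: "quota_sum K m < B"
    and \<alpha>: "1 \<le> \<alpha>" and s: "s \<in> {1..K}" and v: "\<theta> (s - 1) \<le> v" "v \<le> \<theta> s"
    and c: "0 \<le> c" "c = 0 \<or> v = 1"
    and start_eq: "\<alpha> * (quota_sum K m + c * v) = v * resid_C B m s + quota_D \<theta> m s"
    and end_eq: "\<alpha> * (B - quota_sum K m - c) =
      resid_C B m K * ln (\<theta> K / v) + (\<Sum>i=s..<K. m i * ln (\<theta> i / v))"
begin

text \<open>Covers both families of breakpoints: the first threshold has \<open>s = 1\<close> and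
  \<open>v = 1\<close>, the second has \<open>c = 0\<close>.\<close>

definition \<Gamma> :: "nat \<Rightarrow> real" where
  "\<Gamma> j = (if j < s then c else
     c + (resid_C B m j * ln (\<theta> j / v) + (\<Sum>i=s..<j. m i * ln (\<theta> i / v))) / \<alpha>)"

definition pieces :: "(real \<Rightarrow> real) \<Rightarrow> bool" where
  "pieces \<phi> \<longleftrightarrow> (\<forall>u\<in>{0..c}. \<phi> u = v) \<and>
     (\<forall>j\<in>{s..K}. \<forall>u\<in>{\<Gamma> (j - 1)..\<Gamma> j}.
        \<phi> u = v * exp ((\<alpha> * (u - c) - (\<Sum>i=s..<j. m i * ln (\<theta> i / v))) / resid_C B m j))"

text \<open>Price at the breakpoint \<open>\<Gamma> k\<close>. It departs from
  \<open>\<theta>\<close> at \<open>s - 1\<close> because the first exponential piece starts at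
  \<open>v\<close>, possibly above \<open>\<theta> (s - 1)\<close>.\<close>

definition \<tau> :: "nat \<Rightarrow> real" where "\<tau> k = (if k < s then v else \<theta> k)"

lemma v_ge_1: "1 \<le> v"
proof -
  have "s - 1 \<le> K"
    using s by auto
  then show ?thesis
    using \<theta>_ge_1[of "s - 1"] v by linarith
qed

lemma resid_C_Suc: "1 \<le> k \<Longrightarrow> resid_C B m k = resid_C B m (Suc k) + m k"
  by (simp add: resid_C_def)

lemma resid_C_pos: "j \<le> Suc K \<Longrightarrow> 0 < resid_C B m j"
proof -
  assume "j \<le> Suc K"
  then have "(\<Sum>i=1..<j. m i) \<le> (\<Sum>i=1..K. m i)"
    using m_nonneg by (intro sum_mono2) auto
  then show ?thesis
    using quota_less by (simp add: resid_C_def quota_sum_def)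
qed

text \<open>This is the meaning of \<open>end_eq\<close>: the last piece ends where the domain of
  the threshold ends.\<close>

lemma \<Gamma>_K: "\<Gamma> K = B - quota_sum K m"
  using end_eq \<alpha> s by (auto simp: \<Gamma>_def field_simps)

text \<open>Rewrites the breakpoint with the residual budget of the next class: the share
  \<open>m k\<close> taken out of \<open>resid_C\<close> reappears as the new summand. For
  \<open>k = s - 1\<close> both sides are 0.\<close>

lemma \<Gamma>_eq:
  assumes "k \<in> {s - 1..<K}"
  shows "\<alpha> * (\<Gamma> k - c) = resid_C B m (Suc k) * ln (\<tau> k / v) + (\<Sum>i=s..<Suc k. m i * ln (\<theta> i / v))"
proof (cases "k < s")
  case True
  then show ?thesis using assms s v_ge_1 by (auto simp: \<Gamma>_def \<tau>_def)
next
  case False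
  then have "\<alpha> * (\<Gamma> k - c) = resid_C B m k * ln (\<theta> k / v) + (\<Sum>i=s..<k. m i * ln (\<theta> i / v))"
    using \<alpha> by (simp add: \<Gamma>_def)
  then show ?thesis
    using False s resid_C_Suc[of k] by (simp add: \<tau>_def algebra_simps)
qed

lemma \<tau>_props:
  assumes "k \<in> {s - 1..<K}"
  shows "0 < \<tau> k" "\<tau> k \<le> \<tau> (Suc k)" "\<tau> (Suc k) = \<theta> (Suc k)" "\<theta> k \<le> \<tau> k"
proof -
  have "k = s - 1 \<or> s \<le> k"
    using assms by auto
  then show "0 < \<tau> k" "\<tau> k \<le> \<tau> (Suc k)" "\<tau> (Suc k) = \<theta> (Suc k)" "\<theta> k \<le> \<tau> k"
    using assms s v v_ge_1 \<theta>_ge_1[of k] \<theta>_Suc[of "Suc k"] by (auto simp: \<tau>_def)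
qed

lemma \<Gamma>_Suc:
  assumes "k \<in> {s - 1..<K}"
  shows "\<Gamma> (Suc k) = \<Gamma> k + resid_C B m (Suc k) * ln (\<tau> (Suc k) / \<tau> k) / \<alpha>"
proof -
  have "ln (\<tau> (Suc k) / v) = ln (\<tau> (Suc k) / \<tau> k) + ln (\<tau> k / v)"
    using \<tau>_props[OF assms] v_ge_1 by (simp add: ln_div)
  moreover have "\<alpha> * (\<Gamma> (Suc k) - c) =
      resid_C B m (Suc k) * ln (\<tau> (Suc k) / v) + (\<Sum>i=s..<Suc k. m i * ln (\<theta> i / v))"
    using assms \<alpha> by (auto simp: \<Gamma>_def \<tau>_def)
  ultimately have "\<alpha> * (\<Gamma> (Suc k) - \<Gamma> k) = resid_C B m (Suc k) * ln (\<tau> (Suc k) / \<tau> k)"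
    using \<Gamma>_eq[OF assms] by (simp add: algebra_simps)
  then show ?thesis
    using \<alpha> by (simp add: field_simps)
qed

text \<open>Recentres the closed formula at the left breakpoint, the form that
  \<open>exp_pieces\<close> needs.\<close>

lemma piece_eq:
  assumes "k \<in> {s - 1..<K}"
  shows "v * exp ((\<alpha> * (u - c) - (\<Sum>i=s..<Suc k. m i * ln (\<theta> i / v))) / resid_C B m (Suc k)) =
    \<tau> k * exp (\<alpha> * (u - \<Gamma> k) / resid_C B m (Suc k))"
proof -
  have C: "0 < resid_C B m (Suc k)"
    using assms by (intro resid_C_pos) auto
  have "\<alpha> * (u - c) - (\<Sum>i=s..<Suc k. m i * ln (\<theta> i / v)) =
      resid_C B m (Suc k) * ln (\<tau> k / v) + \<alpha> * (u - \<Gamma> k)"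
    using \<Gamma>_eq[OF assms] by (simp add: algebra_simps)
  then have "(\<alpha> * (u - c) - (\<Sum>i=s..<Suc k. m i * ln (\<theta> i / v))) / resid_C B m (Suc k) =
      ln (\<tau> k / v) + \<alpha> * (u - \<Gamma> k) / resid_C B m (Suc k)"
    using C by (simp add: add_divide_distrib)
  then show ?thesis
    using \<tau>_props(1)[OF assms] v_ge_1 by (simp add: exp_add)
qed

lemma pieces_iff:
  "pieces \<phi> \<longleftrightarrow> (\<forall>u\<in>{0..c}. \<phi> u = v) \<and>
    (\<forall>k\<in>{s - 1..<K}. \<forall>u\<in>{\<Gamma> k..\<Gamma> (Suc k)}. \<phi> u = \<tau> k * exp (\<alpha> * (u - \<Gamma> k) / resid_C B m (Suc k)))"
proof -
  have eq: "{s..K} = Suc ` {s - 1..<K}"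
    using s by (auto simp: image_Suc_atLeastLessThan)
  have shift: "(\<forall>j\<in>{s..K}. Q j) \<longleftrightarrow> (\<forall>k\<in>{s - 1..<K}. Q (Suc k))" for Q
    unfolding eq by blast
  show ?thesis
    unfolding pieces_def shift by (intro conj_cong ball_cong refl) (simp_all only: diff_Suc_1 piece_eq)
qed

lemma start: "\<Gamma> (s - 1) = c" "\<tau> (s - 1) = v"
  using s by (auto simp: \<Gamma>_def \<tau>_def)

lemma pieces_exist: "\<exists>\<phi>. pieces \<phi>"
proof -
  have "\<exists>\<phi>. (\<forall>u \<le> \<Gamma> (s - 1). \<phi> u = \<tau> (s - 1)) \<and> \<Gamma> (s - 1) \<le> \<Gamma> K \<and> \<phi> (\<Gamma> K) = \<tau> K \<and>
    (\<forall>k\<in>{s - 1..<K}. \<Gamma> k \<le> \<Gamma> K \<and> \<Gamma> (Suc k) \<le> \<Gamma> K \<and>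
       (\<forall>u\<in>{\<Gamma> k..\<Gamma> (Suc k)}. \<phi> u = \<tau> k * exp (\<alpha> * (u - \<Gamma> k) / resid_C B m (Suc k))))"
    using \<alpha> s resid_C_pos \<tau>_props(1,2) \<Gamma>_Suc by (intro exp_pieces_exist) auto
  then show ?thesis
    unfolding pieces_iff start by (meson atLeastAtMost_iff)
qed

lemma dual_value_piece:
  assumes "k \<in> {s - 1..<K}" "\<tau> k \<le> p" "p \<le> \<tau> (Suc k)"
  shows "dual_value B K \<theta> m p = p * resid_C B m (Suc k) + quota_D \<theta> m (Suc k)"
proof (rule dual_value_eq)
  show "\<theta> i \<le> p" if "i \<in> {1..k}" for i
    using that assms \<theta>_mono[of i k] \<tau>_props(4)[OF assms(1)] by auto
  show "p \<le> \<theta> i" if "i \<in> {Suc k..K}" for i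
    using that assms \<theta>_mono[of "Suc k" i] \<tau>_props(3)[OF assms(1)] by auto
qed (use assms in auto)

text \<open>The dual objective along \<open>\<phi>\<close> and \<open>\<alpha>\<close> times the
  guaranteed value grow equally fast by \<open>exp_pieces\<close>, and \<open>start_eq\<close> makes
  them agree at \<open>u = c\<close>.\<close>

lemma pieces_props:
  assumes "pieces \<phi>"
  shows "c \<le> B - quota_sum K m" "\<phi> (B - quota_sum K m) = \<theta> K"
    "continuous_on {0..B - quota_sum K m} \<phi>" "mono_on {0..B - quota_sum K m} \<phi>"
    "u \<in> {c..B - quota_sum K m} \<Longrightarrow>
       dual_value B K \<theta> m (\<phi> u) = \<alpha> * (quota_sum K m + integral {0..u} \<phi>)"
proof -
  let ?b = "B - quota_sum K m" and ?H = "dual_value B K \<theta> m"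
  have flat: "\<phi> u = v" if "0 \<le> u" "u \<le> c" for u
    using assms that by (auto simp: pieces_iff)
  have "\<Gamma> (s - 1) \<le> \<Gamma> K \<and> \<phi> (\<Gamma> K) = \<tau> K \<and> continuous_on {\<Gamma> (s - 1)..\<Gamma> K} \<phi> \<and>
      mono_on {\<Gamma> (s - 1)..\<Gamma> K} \<phi> \<and>
      (\<forall>u\<in>{\<Gamma> (s - 1)..\<Gamma> K}. (\<phi> has_integral (?H (\<phi> u) - ?H (\<tau> (s - 1))) / \<alpha>) {\<Gamma> (s - 1)..u})"
  proof (rule exp_pieces[where C = "\<lambda>k. resid_C B m (Suc k)"])
    show "\<phi> (\<Gamma> (s - 1)) = \<tau> (s - 1)"
      using start flat c by simp
    fix k assume k: "k \<in> {s - 1..<K}"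
    show "0 < resid_C B m (Suc k) \<and> 0 < \<tau> k \<and> \<tau> k \<le> \<tau> (Suc k)"
      using k \<tau>_props[OF k] by (auto intro!: resid_C_pos)
    show "\<Gamma> (Suc k) = \<Gamma> k + resid_C B m (Suc k) * ln (\<tau> (Suc k) / \<tau> k) / \<alpha>"
      by (rule \<Gamma>_Suc[OF k])
    show "\<phi> u = \<tau> k * exp (\<alpha> * (u - \<Gamma> k) / resid_C B m (Suc k))" if "u \<in> {\<Gamma> k..\<Gamma> (Suc k)}" for u
      using assms k that by (simp add: pieces_iff)
    show "?H p - ?H (\<tau> k) = resid_C B m (Suc k) * (p - \<tau> k)" if "\<tau> k \<le> p" "p \<le> \<tau> (Suc k)" for p
      using dual_value_piece[OF k that] dual_value_piece[OF k order.refl \<tau>_props(2)[OF k]]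
      by (simp add: algebra_simps)
  qed (use \<alpha> s in auto)
  then have cb: "c \<le> ?b" and end_val: "\<phi> ?b = \<theta> K" and cont: "continuous_on {c..?b} \<phi>"
    and mono: "mono_on {c..?b} \<phi>"
    and int: "\<And>u. u \<in> {c..?b} \<Longrightarrow> (\<phi> has_integral (?H (\<phi> u) - ?H v) / \<alpha>) {c..u}"
    using s by (simp_all add: start \<Gamma>_K \<tau>_def del: One_nat_def)
  show "c \<le> ?b" "\<phi> ?b = \<theta> K" by fact+
  have un: "{0..?b} = {0..c} \<union> {c..?b}"
    using c cb by auto
  have "continuous_on {0..c} \<phi>"
    by (rule continuous_on_eq[where f = "\<lambda>_. v"]) (auto simp: flat)
  then show "continuous_on {0..?b} \<phi>"
    unfolding un using cont by (intro continuous_on_closed_Un) auto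
  show "mono_on {0..?b} \<phi>"
  proof (rule mono_onI)
    fix d e assume de: "d \<in> {0..?b}" "e \<in> {0..?b}" "d \<le> e"
    \<comment> \<open>\<open>\<phi>\<close> is constant up to \<open>c\<close>, so arguments may be
      moved up to \<open>c\<close> before using monotonicity there.\<close>
    have "\<phi> d = \<phi> (max c d)" "\<phi> e = \<phi> (max c e)"
      using de flat[of d] flat[of e] flat[of c] c by (auto simp: max_def)
    then show "\<phi> d \<le> \<phi> e"
      using de cb mono_onD[OF mono, of "max c d" "max c e"] by auto
  qed
  assume u: "u \<in> {c..?b}"
  have "s - 1 \<in> {s - 1..<K}"
    using s by auto
  from dual_value_piece[OF this] have Hv: "?H v = v * resid_C B m s + quota_D \<theta> m s"
    using \<tau>_props(2)[OF \<open>s - 1 \<in> _\<close>] s by (simp add: start del: One_nat_def)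
  have "((\<lambda>_. v) has_integral c * v) {0..c}"
    using has_integral_const_real[of v 0 c] c by simp
  then have "(\<phi> has_integral c * v) {0..c}"
    by (rule has_integral_eq[rotated]) (simp add: flat)
  then have "(\<phi> has_integral c * v + (?H (\<phi> u) - ?H v) / \<alpha>) {0..u}"
    using u c int[OF u] by (intro has_integral_combine[of 0 c u]) auto
  then have "integral {0..u} \<phi> = c * v + (?H (\<phi> u) - ?H v) / \<alpha>"
    by (rule integral_unique)
  then show "?H (\<phi> u) = \<alpha> * (quota_sum K m + integral {0..u} \<phi>)"
    using \<alpha> start_eq Hv by (simp add: field_simps)
qed

lemma pieces_threshold_function:
  assumes "pieces \<phi>"
  shows "threshold_function B K \<theta> m \<phi>"
proof -
  have "\<phi> 0 = v"
    using assms c by (auto simp: pieces_def)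
  moreover have "\<phi> 0 \<le> \<phi> u \<and> \<phi> u \<le> \<phi> (B - quota_sum K m)" if "u \<in> {0..B - quota_sum K m}" for u
    using that by (auto intro!: mono_onD[OF pieces_props(4)[OF assms]])
  ultimately show ?thesis
    using pieces_props(2,4)[OF assms] v_ge_1 by (fastforce simp: threshold_function_def)
qed

text \<open>The price is \<open>\<phi> u\<close> from \<open>c\<close> on, where the dual comparison
  is an equality, and 0 before \<open>c\<close>.\<close>

lemma pieces_competitive:
  assumes "pieces \<phi>"
  shows "competitive B K \<theta> m (q_threshold B K m \<phi>) \<alpha>"
proof -
  let ?b = "B - quota_sum K m"
  note props = pieces_props[OF assms]
  interpret quota_problem B K \<theta> m \<phi>
    using pieces_threshold_function[OF assms] props(3) by unfold_locales
  show ?thesis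
  proof (rule competitiveI)
    fix u assume u: "0 \<le> u" "u \<le> ?b"
    show "\<exists>p. (\<forall>v. 1 \<le> v \<and> v \<le> \<theta> K \<and> p < v \<longrightarrow> (\<exists>\<eta>. u < \<eta> \<and> \<eta> \<le> ?b \<and> \<phi> \<eta> \<le> v)) \<and>
        (p = 0 \<or> \<phi> u \<le> p \<and> dual_value B K \<theta> m p \<le> \<alpha> * (quota_sum K m + integral {0..u} \<phi>))"
    proof (cases "u < c")
      case True
      then have "\<phi> c = v" "v = 1"
        using c u assms[unfolded pieces_def] by auto
      then show ?thesis
        \<comment> \<open>The witness \<open>c\<close> lies beyond \<open>u\<close> and has price 1,
          which every agent can pay.\<close>
        using True props(1) by (intro exI[of _ 0] conjI allI impI exI[of _ c]) auto
    next
      case False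
      \<comment> \<open>\<open>\<phi>\<close> climbs continuously to \<open>\<theta> K\<close>, so
        it takes the value \<open>v\<close> at some \<open>\<eta>\<close>; \<open>\<eta>\<close>
        differs from \<open>u\<close> as \<open>\<phi> u < v\<close>.\<close>
      have "\<exists>\<eta>. u < \<eta> \<and> \<eta> \<le> ?b \<and> \<phi> \<eta> \<le> v" if v: "v \<le> \<theta> K" "\<phi> u < v" for v
      proof -
        have "\<exists>\<eta>\<ge>u. \<eta> \<le> ?b \<and> \<phi> \<eta> = v"
          using v u props(2) by (intro IVT' continuous_on_subset[OF props(3)]) auto
        then show ?thesis
          using v by (metis less_irrefl order.order_iff_strict order.refl)
      qed
      then show ?thesis
        using False u props(5)[of u] by (intro exI[of _ "\<phi> u"]) auto
    qed
  qed (rule \<alpha>)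
qed

end

subsection \<open>The two regimes of the quota sum\<close>

lemma lambert_W:
  assumes "0 < x"
  shows "0 < lambert_W x" "lambert_W x * exp (lambert_W x) = x"
proof -
  \<comment> \<open>The map is not monotone on negative numbers, but comparison with a positive
    \<open>b\<close> suffices, since negative \<open>a\<close> give negative values.\<close>
  have mono: "a * exp a < b * exp b" if "0 < b" "a < b" for a b :: real
  proof (cases "0 \<le> a")
    case True
    then show ?thesis using that by (intro mult_strict_mono) auto
  next
    case False
    then have "a * exp a < 0" by (simp add: mult_neg_pos)
    also have "0 < b * exp b" using that by simp
    finally show ?thesis .
  qed
  have "\<exists>w\<ge>0. w \<le> x \<and> w * exp w = x"
    using assms by (intro IVT') (auto intro!: continuous_intros)
  then obtain w where w: "0 \<le> w" "w * exp w = x"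
    by auto
  then have "0 < w"
    using assms by (cases "w = 0") auto
  have pos: "0 < w'" if "w' * exp w' = x" for w'
    using assms that by (auto simp: zero_less_mult_iff)
  have "lambert_W x = w"
    unfolding lambert_W_def
  proof (rule the_equality)
    fix w' assume "- 1 \<le> w' \<and> w' * exp w' = x"
    then show "w' = w"
      using pos[of w'] \<open>0 < w\<close> w mono[of w w'] mono[of w' w] by (cases w w' rule: linorder_cases) auto
  qed (use w in auto)
  then show "0 < lambert_W x" "lambert_W x * exp (lambert_W x) = x"
    using w \<open>0 < w\<close> by auto
qed

lemma ln_lambert_W:
  assumes "0 < x"
  shows "ln (lambert_W x) = ln x - lambert_W x"
proof -
  have "ln x = ln (lambert_W x * exp (lambert_W x))"
    using lambert_W(2)[OF assms] by simp
  then show ?thesis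
    using lambert_W(1)[OF assms] by (simp add: ln_mult)
qed

section \<open>The two parameter settings and the exhausted budget\<close>

context quota_classes
begin

lemma quota_sum_last: "M = (\<Sum>j=1..<K. m j) + m K"
proof -
  have "{1..K} = insert K {1..<K}"
    using K by auto
  then show ?thesis
    by (simp add: quota_sum_def)
qed

lemma resid_C_K: "resid_C B m K = B - M + m K"
  by (simp add: resid_C_def quota_sum_last)

text \<open>Collecting the multiples of \<open>ln (\<theta> K)\<close> leaves the coefficient
  \<open>resid_C B m K\<close>; this turns the definition of \<open>alpha0\<close> into the shape of
  \<open>end_eq\<close>.\<close>

lemma alpha0_eq:
  "B * (alpha0 B K \<theta> m - 1) = resid_C B m K * ln (\<theta> K) + (\<Sum>i=1..<K. m i * ln (\<theta> i))"
proof -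
  have "B * (\<Sum>j=1..<K. m j / B * ln (\<theta> K / \<theta> j)) = (\<Sum>j=1..<K. m j * ln (\<theta> K) - m j * ln (\<theta> j))"
    unfolding sum_distrib_left
  proof (rule sum.cong)
    fix j assume "j \<in> {1..<K}"
    then have "1 \<le> \<theta> j" "1 \<le> \<theta> K"
      using \<theta>_ge_1 by auto
    then show "B * (m j / B * ln (\<theta> K / \<theta> j)) = m j * ln (\<theta> K) - m j * ln (\<theta> j)"
      using B by (simp add: ln_div algebra_simps)
  qed simp
  also have "\<dots> = (\<Sum>j=1..<K. m j) * ln (\<theta> K) - (\<Sum>j=1..<K. m j * ln (\<theta> j))"
    by (simp only: sum_subtractf sum_distrib_right)
  finally show ?thesis
    by (simp add: alpha0_def resid_C_def algebra_simps)
qed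

lemma m_ln_nonneg: "j \<in> {1..K} \<Longrightarrow> 0 \<le> m j * ln (\<theta> j)"
  using m_nonneg \<theta>_ge_1 by (intro mult_nonneg_nonneg) auto

lemma alpha0_ge_1: "1 \<le> alpha0 B K \<theta> m"
proof -
  have "0 \<le> (\<Sum>i=1..<K. m i * ln (\<theta> i))"
    using m_ln_nonneg by (intro sum_nonneg) auto
  moreover have "0 \<le> resid_C B m K * ln (\<theta> K)"
    using quota_le m_nonneg[of K] K \<theta>_ge_1[of K] by (intro mult_nonneg_nonneg) (auto simp: resid_C_K)
  ultimately have "0 \<le> B * (alpha0 B K \<theta> m - 1)"
    by (simp add: alpha0_eq)
  then show ?thesis
    using B by (simp add: zero_le_mult_iff)
qed

text \<open>The flat part ends at the \<open>c\<close> for which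
  \<open>\<alpha> * (M + c) = B\<close>, the dual objective at price 1. The hypothesis
  \<open>le\<close> says that this \<open>c\<close> is nonnegative.\<close>

lemma threshold0_less:
  assumes "M < B" and le: "M \<le> B / alpha0 B K \<theta> m"
  shows "(\<exists>\<phi>. is_threshold0 B K \<theta> m \<phi>) \<and>
    (\<forall>\<phi>. is_threshold0 B K \<theta> m \<phi> \<longrightarrow> threshold_function B K \<theta> m \<phi> \<and>
       competitive B K \<theta> m (q_threshold B K m \<phi>) (alpha0 B K \<theta> m))"
proof -
  let ?\<alpha> = "alpha0 B K \<theta> m" and ?c = "B / alpha0 B K \<theta> m - M"
  have \<alpha>: "1 \<le> ?\<alpha>" by (rule alpha0_ge_1)
  have \<alpha>_c: "?\<alpha> * (M + ?c) = B"
    using \<alpha> by simp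
  interpret threshold_pieces B K \<theta> m ?\<alpha> 1 ?c 1
  proof unfold_locales
    show "?\<alpha> * (B - M - ?c) = resid_C B m K * ln (\<theta> K / 1) + (\<Sum>i=1..<K. m i * ln (\<theta> i / 1))"
      using alpha0_eq \<alpha>_c by (simp add: algebra_simps)
    show "?\<alpha> * (M + ?c * 1) = 1 * resid_C B m 1 + quota_D \<theta> m 1"
      using \<alpha>_c by (simp add: resid_C_def quota_D_def)
  qed (use assms \<alpha> \<theta>_0 \<theta>_Suc m_nonneg K \<theta>_ge_1[of 1] in auto)
  have \<Gamma>: "breakpoint0 B K \<theta> m j = \<Gamma> j" for j
    by (cases j) (simp_all add: breakpoint0_def \<Gamma>_def Let_def add_divide_distrib del: One_nat_def)
  have "is_threshold0 B K \<theta> m \<phi> \<longleftrightarrow> pieces \<phi>" for \<phi>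
  proof -
    have "breakpoint0 B K \<theta> m 0 = ?c"
      by (simp add: breakpoint0_def Let_def)
    moreover have "?\<alpha> * (u + M) - B = ?\<alpha> * (u - ?c)" for u
      using \<alpha>_c unfolding distrib_left right_diff_distrib by linarith
    ultimately show ?thesis
      unfolding is_threshold0_def pieces_def \<Gamma> by simp
  qed
  then show ?thesis
    using pieces_exist pieces_threshold_function pieces_competitive by blast
qed

text \<open>If the quotas exhaust the budget, the hypothesis forces \<open>alpha0 = 1\<close>, and every class with a
  positive quota has \<open>\<theta> j = 1\<close>. The divisors \<open>resid_C\<close> may then be \<open>0\<close>.\<close>

lemma threshold0_eq:
  assumes MB: "M = B" and le: "M \<le> B / alpha0 B K \<theta> m"
  shows "(\<exists>\<phi>. is_threshold0 B K \<theta> m \<phi>) \<and>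
    (\<forall>\<phi>. is_threshold0 B K \<theta> m \<phi> \<longrightarrow> threshold_function B K \<theta> m \<phi> \<and>
       competitive B K \<theta> m (q_threshold B K m \<phi>) (alpha0 B K \<theta> m))"
proof -
  have "B * alpha0 B K \<theta> m \<le> B * 1"
    using le B alpha0_ge_1 MB by (simp add: field_simps)
  then have \<alpha>: "alpha0 B K \<theta> m = 1"
    using B alpha0_ge_1 by (intro antisym) (simp_all only: mult_le_cancel_left_pos)
  have "(\<Sum>i=1..K. m i * ln (\<theta> i)) = m K * ln (\<theta> K) + (\<Sum>i=1..<K. m i * ln (\<theta> i))"
  proof -
    have "{1..K} = insert K {1..<K}"
      using K by auto
    then show ?thesis by simp
  qed
  then have "(\<Sum>i=1..K. m i * ln (\<theta> i)) = 0"
    using alpha0_eq \<alpha> MB by (simp add: resid_C_K)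
  then have ln0: "m i * ln (\<theta> i) = 0" if "i \<in> {1..K}" for i
    using that m_ln_nonneg by (subst (asm) sum_nonneg_eq_0_iff) auto
  \<comment> \<open>As \<open>M = B\<close>, the residual budget of \<open>j\<close> is the sum of
    the quotas from \<open>j\<close> on. A positive one among them forces
    \<open>\<theta> i = 1\<close>, hence \<open>\<theta> j = 1\<close>.\<close>
  have C0: "resid_C B m j * ln (\<theta> j) = 0" if j: "j \<in> {1..K}" for j
  proof -
    have "M = (\<Sum>i=1..<j. m i) + (\<Sum>i=j..K. m i)"
      unfolding quota_sum_def using j
      by (subst sum.union_disjoint[symmetric]) (auto intro: sum.cong)
    then have "resid_C B m j * ln (\<theta> j) = (\<Sum>i=j..K. m i * ln (\<theta> j))"
      using MB by (simp add: resid_C_def sum_distrib_right)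
    also have "\<dots> = 0"
    proof (intro sum.neutral ballI)
      fix i assume i: "i \<in> {j..K}"
      then have "1 \<le> \<theta> j" "\<theta> j \<le> \<theta> i"
        using j \<theta>_ge_1[of j] \<theta>_mono[of j i] by auto
      then have "ln (\<theta> i) = 0 \<Longrightarrow> ln (\<theta> j) = 0"
        by (metis ln_ge_zero ln_mono order.antisym zero_less_one less_le_trans)
      then show "m i * ln (\<theta> j) = 0"
        using ln0[of i] i j by auto
    qed
    finally show ?thesis .
  qed
  have S0: "(\<Sum>i=1..<j. m i * ln (\<theta> i)) = 0" if "j \<in> {1..K}" for j
    using that ln0 by (intro sum.neutral) auto
  \<comment> \<open>All breakpoints collapse to the only point of the domain.\<close>
  have \<Gamma>: "breakpoint0 B K \<theta> m j = 0" if "j \<le> K" for j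
    using that C0[of j] S0[of j] by (cases "j = 0") (auto simp: breakpoint0_def Let_def \<alpha> MB)
  have iff: "is_threshold0 B K \<theta> m \<phi> \<longleftrightarrow> \<phi> 0 = 1" for \<phi>
  proof -
    \<comment> \<open>The numerator vanishes, so the quotient is 0 even for divisor 0.\<close>
    have "exp ((alpha0 B K \<theta> m * (0 + M) - B - (\<Sum>i=1..<j. m i * ln (\<theta> i))) / resid_C B m j) = 1"
      if "j \<in> {1..K}" for j
      using S0[OF that] by (simp add: \<alpha> MB)
    then show ?thesis
      by (force simp: is_threshold0_def \<Gamma>)
  qed
  have m\<theta>: "m j * \<theta> j = m j" if "j \<in> {1..K}" for j
    using ln0[OF that] that \<theta>_ge_1[of j] by auto
  have "threshold_function B K \<theta> m \<phi> \<and> competitive B K \<theta> m (q_threshold B K m \<phi>) (alpha0 B K \<theta> m)"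
    if "\<phi> 0 = 1" for \<phi>
  proof
    show thr: "threshold_function B K \<theta> m \<phi>"
      using that \<theta>_ge_1[of K] MB by (auto simp: threshold_function_def mono_on_def)
    interpret quota_problem B K \<theta> m \<phi>
      using thr MB by unfold_locales auto
    show "competitive B K \<theta> m (q_threshold B K m \<phi>) (alpha0 B K \<theta> m)"
    proof (rule competitiveI)
      have \<theta>: "\<theta> j \<le> \<theta> K" if "j \<in> {1..K}" for j
        using that \<theta>_mono[of j K] by auto
      fix u assume "0 \<le> u" "u \<le> B - M"
      then have u: "u = 0"
        using MB by simp
      \<comment> \<open>At price \<open>\<theta> K\<close> no agent has excess valuation, and the
        dual objective is the sum of \<open>m j * \<theta> j\<close>, which is
        \<open>M\<close>.\<close>
      have "dual_value B K \<theta> m (\<theta> K) = \<theta> K * M - (\<Sum>j=1..K. \<theta> K * m j - m j)"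
        using \<theta> m\<theta> by (auto simp: dual_value_def MB max_def algebra_simps intro!: sum.cong)
      also have "\<dots> = M"
        by (simp add: quota_sum_def sum_subtractf sum_distrib_left)
      finally show "\<exists>p. (\<forall>v. 1 \<le> v \<and> v \<le> \<theta> K \<and> p < v \<longrightarrow> (\<exists>\<eta>. u < \<eta> \<and> \<eta> \<le> B - M \<and> \<phi> \<eta> \<le> v)) \<and>
          (p = 0 \<or> \<phi> u \<le> p \<and> dual_value B K \<theta> m p \<le> alpha0 B K \<theta> m * (M + integral {0..u} \<phi>))"
        using that \<theta>_ge_1[of K] by (intro exI[of _ "\<theta> K"]) (auto simp: u \<alpha>)
    qed (simp add: \<alpha>)
  qed
  then show ?thesis
    by (auto simp: iff)
qed

text \<open>Multiplied out, the hypothesis \<open>range\<close> places \<open>vstar\<close> above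
  \<open>\<theta> (s - 1)\<close> and at most at \<open>\<theta> s\<close>. \<open>start_eq\<close>
  is the definition of \<open>vstar\<close>, and \<open>end_eq\<close> is the logarithm of the
  equation defining Lambert's W.\<close>

lemma threshold_less:
  assumes "M < B" and s: "s \<in> {1..K}"
    and range: "M \<in> {(\<theta> (s - 1) * resid_C B m s + quota_D \<theta> m s) / alpha B K \<theta> m s <..
                     (\<theta> s * resid_C B m s + quota_D \<theta> m s) / alpha B K \<theta> m s}"
  shows "(\<exists>\<phi>. is_threshold B K \<theta> m s \<phi>) \<and>
    (\<forall>\<phi>. is_threshold B K \<theta> m s \<phi> \<longrightarrow> threshold_function B K \<theta> m \<phi> \<and>
       competitive B K \<theta> m (q_threshold B K m \<phi>) (alpha B K \<theta> m s))"
proof -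
  define \<alpha> v where "\<alpha> = alpha B K \<theta> m s" and "v = vstar B K \<theta> m s"
  define C D X where "C = resid_C B m s" and "D = quota_D \<theta> m s"
    and "X = (\<Sum>i=s..<K. m i * ln (\<theta> K / \<theta> i))"
  define q where "q = \<theta> K * (B - M) / M"
  define A where "A = q * exp (- (X / C)) * exp (- (D * (B - M) / (C * M)))"
  have \<alpha>_eq: "\<alpha> = D / M + C / (B - M) * lambert_W A"
    by (simp add: \<alpha>_def alpha_def Let_def A_def q_def C_def D_def X_def)
  have v_eq: "v = (\<alpha> * M - D) / C"
    by (simp add: v_def vstar_def \<alpha>_def C_def D_def)
  have "(\<Sum>i=1..<s. m i) \<le> M"
    unfolding quota_sum_def using s m_nonneg by (intro sum_mono2) auto
  then have C: "0 < C"
    using assms(1) by (simp add: C_def resid_C_def)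
  have "0 \<le> M"
    unfolding quota_sum_def using m_nonneg by (intro sum_nonneg)
  have "D \<ge> (\<Sum>i=1..<s. m i * 1)"
    unfolding D_def quota_D_def using s m_nonneg \<theta>_ge_1 by (intro sum_mono mult_left_mono) auto
  then have CD: "B \<le> C + D" and D0: "0 \<le> D"
    using sum_nonneg[of "{1..<s}" m] s m_nonneg by (auto simp: C_def resid_C_def)
  have \<theta>1: "1 \<le> \<theta> (s - 1)" "1 \<le> \<theta> s" "1 \<le> \<theta> K"
    using s \<theta>_ge_1 by auto
  \<comment> \<open>For \<open>M = 0\<close>, division by 0 yields 0, so \<open>A\<close>, W and
    \<open>alpha\<close> vanish and the interval in \<open>range\<close> is empty.\<close>
  have M: "0 < M"
  proof (rule ccontr)
    assume "\<not> 0 < M"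
    then have "M = 0"
      using \<open>0 \<le> M\<close> by simp
    have "lambert_W 0 = 0"
      unfolding lambert_W_def by (rule the_equality) auto
    then have "alpha B K \<theta> m s = 0"
      using \<alpha>_eq \<open>M = 0\<close> by (simp add: \<alpha>_def A_def q_def)
    then show False
      using range \<open>M = 0\<close> by simp
  qed
  have A: "0 < A"
    using M assms(1) \<theta>1 by (simp add: A_def q_def)
  have W: "0 < lambert_W A"
    by (rule lambert_W[OF A])
  have "0 < \<alpha>"
    unfolding \<alpha>_eq using W C M D0 assms(1) by (intro add_nonneg_pos) auto
  have "\<theta> (s - 1) * C + D < \<alpha> * M" "\<alpha> * M \<le> \<theta> s * C + D"
    using range \<open>0 < \<alpha>\<close> by (simp_all add: \<alpha>_def[symmetric] C_def[symmetric] D_def[symmetric] field_simps)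
  then have v: "\<theta> (s - 1) \<le> v" "v \<le> \<theta> s"
    using C by (simp_all add: v_eq field_simps)
  have start: "\<alpha> * M = v * C + D"
    using C by (simp add: v_eq)
  \<comment> \<open>Since \<open>v\<close> is at least 1, \<open>\<alpha> * M = v * C + D\<close> is
    at least \<open>C + D\<close>, hence at least \<open>B\<close>, which exceeds
    \<open>M\<close>.\<close>
  have "1 * C \<le> v * C"
    using v \<theta>1 C by (intro mult_right_mono) auto
  then have "1 * M \<le> \<alpha> * M"
    using start CD assms(1) by simp
  then have \<alpha>: "1 \<le> \<alpha>"
    using M by (simp only: mult_le_cancel_right_pos)
  \<comment> \<open>Inserting \<open>\<alpha>\<close> cancels \<open>D\<close>, so the logarithm of
    \<open>v\<close> is controlled by that of W.\<close>
  have v_W: "v = M / (B - M) * lambert_W A"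
    using C M assms(1) by (simp add: v_eq \<alpha>_eq field_simps)
  have v0: "0 < v"
    using v \<theta>1 by simp
  have q: "0 < q" "ln q = ln (\<theta> K) + ln (B - M) - ln M"
    using M assms(1) \<theta>1 by (simp_all add: q_def ln_div ln_mult)
  have "A = exp (ln q + - (X / C) + - (D * (B - M) / (C * M)))"
    by (simp only: A_def exp_add exp_ln[OF q(1)])
  then have "ln (lambert_W A) = ln q - X / C - D * (B - M) / (C * M) - lambert_W A"
    using ln_lambert_W[OF A] by simp
  moreover have "ln v = ln M - ln (B - M) + ln (lambert_W A)"
    using W M assms(1) by (simp add: v_W ln_mult ln_div)
  ultimately have "ln (\<theta> K / v) = lambert_W A + X / C + D * (B - M) / (C * M)"
    using \<theta>1 v0 q(2) by (simp add: ln_div)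
  then have "C * ln (\<theta> K / v) = C * lambert_W A + X + D / M * (B - M)"
    using C by (simp add: distrib_left)
  moreover have "\<alpha> * (B - M) = D / M * (B - M) + C * lambert_W A"
    using assms(1) by (simp add: \<alpha>_eq distrib_right)
  ultimately have "C * ln (\<theta> K / v) - X = \<alpha> * (B - M)"
    by simp
  \<comment> \<open>Write each logarithm in \<open>X\<close> as
    \<open>ln (\<theta> K / v) - ln (\<theta> i / v)\<close>; the quotas from \<open>s\<close> to
    \<open>K - 1\<close> add up to \<open>C - resid_C B m K\<close>.\<close>
  moreover have "C * ln (\<theta> K / v) - X = resid_C B m K * ln (\<theta> K / v) + (\<Sum>i=s..<K. m i * ln (\<theta> i / v))"
  proof -
    have "(\<Sum>i=s..<K. m i * ln (\<theta> i / v)) = (\<Sum>i=s..<K. m i * ln (\<theta> K / v) - m i * ln (\<theta> K / \<theta> i))"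
    proof (rule sum.cong)
      fix i assume "i \<in> {s..<K}"
      then have "1 \<le> \<theta> i"
        using \<theta>_ge_1[of i] by auto
      then show "m i * ln (\<theta> i / v) = m i * ln (\<theta> K / v) - m i * ln (\<theta> K / \<theta> i)"
        using v0 \<theta>1 by (simp add: ln_div algebra_simps)
    qed simp
    also have "\<dots> = (\<Sum>i=s..<K. m i) * ln (\<theta> K / v) - X"
      by (simp add: X_def sum_subtractf sum_distrib_right)
    also have "(\<Sum>i=s..<K. m i) = C - resid_C B m K"
      using s sum.atLeastLessThan_concat[of 1 s K m] by (simp add: C_def resid_C_def)
    finally show ?thesis
      by (simp add: algebra_simps)
  qed
  ultimately have "end": "\<alpha> * (B - M - 0) = resid_C B m K * ln (\<theta> K / v) + (\<Sum>i=s..<K. m i * ln (\<theta> i / v))"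
    by simp
  interpret threshold_pieces B K \<theta> m \<alpha> v 0 s
    by unfold_locales
      (use "end" start \<alpha> v s assms(1) \<theta>_0 \<theta>_Suc m_nonneg in \<open>auto simp: C_def D_def\<close>)
  have \<Gamma>: "breakpoint B K \<theta> m s j = \<Gamma> j" for j
    by (simp add: breakpoint_def \<Gamma>_def Let_def add_divide_distrib flip: \<alpha>_def v_def)
  have iff: "is_threshold B K \<theta> m s \<phi> \<longleftrightarrow> pieces \<phi>" for \<phi>
  proof -
    \<comment> \<open>With \<open>c = 0\<close>, \<open>pieces\<close> also fixes
      \<open>\<phi> 0\<close>; this value comes from piece \<open>s\<close> at \<open>u = 0\<close>,
      where the sum is empty.\<close>
    have "\<phi> 0 = v" if *: "\<forall>j\<in>{s..K}. \<forall>u\<in>{\<Gamma> (j - 1)..\<Gamma> j}.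
        \<phi> u = v * exp ((\<alpha> * u - (\<Sum>i=s..<j. m i * ln (\<theta> i / v))) / resid_C B m j)"
    proof -
      have "\<Gamma> (s - 1) = 0" "0 \<le> \<Gamma> s"
        using s C \<alpha> v v0 by (auto simp: \<Gamma>_def C_def)
      then show ?thesis
        using *[rule_format, of s 0] s by auto
    qed
    then show ?thesis
      by (auto simp: is_threshold_def pieces_def \<Gamma> Let_def simp flip: \<alpha>_def v_def)
  qed
  show ?thesis
    unfolding iff using pieces_exist pieces_threshold_function pieces_competitive
    by (auto simp flip: \<alpha>_def)
qed

end

theorem theorem1:
  fixes B :: real and K :: nat and \<theta> m :: "nat \<Rightarrow> real"
  assumes "B > 0" and "K \<ge> 1"
    and "\<theta> 0 = 1" and "\<forall>j\<in>{1..K}. \<theta> (j - 1) \<le> \<theta> j"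
    and "\<forall>j\<in>{1..K}. m j \<ge> 0" and "quota_sum K m \<le> B"
  shows
    "(quota_sum K m \<le> B / alpha0 B K \<theta> m \<longrightarrow>
        (\<exists>\<phi>. is_threshold0 B K \<theta> m \<phi>) \<and>
        (\<forall>\<phi>. is_threshold0 B K \<theta> m \<phi> \<longrightarrow>
           threshold_function B K \<theta> m \<phi> \<and>
           competitive B K \<theta> m (q_threshold B K m \<phi>) (alpha0 B K \<theta> m))) \<and>
     (\<forall>js\<in>{1..K}. quota_sum K m < B \<longrightarrow>
        quota_sum K m \<in> {(\<theta> (js - 1) * resid_C B m js + quota_D \<theta> m js) / alpha B K \<theta> m js <..
                     (\<theta> js * resid_C B m js + quota_D \<theta> m js) / alpha B K \<theta> m js} \<longrightarrow>
        (\<exists>\<phi>. is_threshold B K \<theta> m js \<phi>) \<and>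
        (\<forall>\<phi>. is_threshold B K \<theta> m js \<phi> \<longrightarrow>
           threshold_function B K \<theta> m \<phi> \<and>
           competitive B K \<theta> m (q_threshold B K m \<phi>) (alpha B K \<theta> m js)))"
proof -
  interpret quota_classes B K \<theta> m
    using assms by unfold_locales auto
  show ?thesis
    using threshold0_less threshold0_eq threshold_less quota_le order.not_eq_order_implies_strict by blast
qed

end
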